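(* Let $G$ be a connected block-complete multipartite graph. If $G$ has an admissible exact-six orientation, then $G$ is an exact $6$-leaf power.
   Context: Graphs are finite, simple, undirected and nonempty. A graph $G$ is an exact $k$-leaf power if there is a tree $T$ whose leaf set is $V(G)$ such that for distinct $u,v\in V(G)$, $uv\in E(G)$ if and only if $\operatorname{dist}_T(u,v)=k$; the vertex of a one-vertex tree counts as a leaf. A connected graph is block-complete multipartite if every block of it is a complete multipartite graph. If $B$ is a block and $x$ is a cutvertex of $G$ contained in $B$, let $P_B(x)$ denote the partite class of $B$ containing $x$. An exact-six orientation of a block-complete multipartite graph $G$: for every complete bipartite block $B=K_{P,Q}$ (including $K_2=K_{1,1}$), one of the two classes $P,Q$ is chosen as the short side of $B$; for a block with at least three partite classes, every non-singleton partite class is declared short. A cutvertex $x$ is exposed in an incident block $B$ if $P_B(x)$ is short and $|P_B(x)|\ge2$. The orientation is admissible if every cutvertex of $G$ is exposed in at most one incident block. *)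

theory Defs
  imports "Graph_Theory.Graph_Theory" "HOL-Library.Disjoint_Sets"
begin

text \<open>
  A finite simple undirected graph is a \<open>pair_graph\<close> of the Graph Theory library: a finite,
  loop-free digraph whose arc relation is symmetric, an edge \<open>uv\<close> being the two arcs
  \<open>(u,v)\<close> and \<open>(v,u)\<close>.  Nonemptiness is part of the library's \<open>connected\<close>.
\<close>

section \<open>Exact leaf powers\<close>

text \<open>
  The library's \<open>tree\<close> cannot be used for symmetric digraphs: there \<open>u, v, u\<close> is
  a cycle for every edge \<open>uv\<close>.  The cycles of an undirected simple graph are those of length
  at least three.
\<close>

definition undirected_tree :: "'a pair_pre_digraph \<Rightarrow> bool" where
  "undirected_tree T \<longleftrightarrow> pair_graph T \<and> connected (with_proj T) \<and>
     \<not> (\<exists>p. pre_digraph.cycle (with_proj T) p \<and> 3 \<le> length p)"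

definition leaves :: "'a pair_pre_digraph \<Rightarrow> 'a set" where
  "leaves T = {v \<in> pverts T. out_degree (with_proj T) v = 1 \<or> pverts T = {v}}"

definition graph_dist :: "'a pair_pre_digraph \<Rightarrow> 'a \<Rightarrow> 'a \<Rightarrow> ereal" where
  "graph_dist G u v = wf_digraph.\<mu> (with_proj G) (\<lambda>_. 1) u v"

text \<open>
  The vertices of \<open>G\<close> are embedded by \<open>Inl\<close> as the leaves of the tree; every finite tree
  with leaf set \<open>V(G)\<close> has a copy of this form, since its inner vertices can be renamed by
  natural numbers.
\<close>

definition exact_leaf_power :: "nat \<Rightarrow> 'a pair_pre_digraph \<Rightarrow> bool" where
  "exact_leaf_power k G \<longleftrightarrow>
     (\<exists>T :: ('a + nat) pair_pre_digraph.
        undirected_tree T \<and> leaves T = Inl ` pverts G \<and>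
        (\<forall>u \<in> pverts G. \<forall>v \<in> pverts G. u \<noteq> v \<longrightarrow>
           ((u, v) \<in> parcs G \<longleftrightarrow> graph_dist T (Inl u) (Inl v) = ereal (real k))))"

section \<open>Blocks and complete multipartite graphs\<close>

text \<open>A cutvertex separates two other vertices of the same component.\<close>

definition cutvertex :: "'a pair_pre_digraph \<Rightarrow> 'a \<Rightarrow> bool" where
  "cutvertex G v \<longleftrightarrow> v \<in> pverts G \<and>
     (\<exists>x \<in> pverts G - {v}. \<exists>y \<in> pverts G - {v}.
        x \<rightarrow>\<^sup>*\<^bsub>with_proj G\<^esub> y \<and>
        \<not> x \<rightarrow>\<^sup>*\<^bsub>pre_digraph.del_vert (with_proj G) v\<^esub> y)"

definition nonseparable :: "'a pair_pre_digraph \<Rightarrow> bool" where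
  "nonseparable B \<longleftrightarrow> pair_graph B \<and> connected (with_proj B) \<and> \<not> (\<exists>v. cutvertex B v)"

text \<open>
  Library subgraphs of a symmetric digraph need not be symmetric; \<open>nonseparable\<close> restricts
  both the block and its competitors to undirected graphs.
\<close>

definition block :: "'a pair_pre_digraph \<Rightarrow> 'a pair_pre_digraph \<Rightarrow> bool" where
  "block G B \<longleftrightarrow> subgraph (with_proj B) (with_proj G) \<and> nonseparable B \<and>
     (\<forall>B'. subgraph (with_proj B') (with_proj G) \<and> nonseparable B' \<and>
           subgraph (with_proj B) (with_proj B') \<longrightarrow> B' = B)"

definition complete_multipartition :: "'a pair_pre_digraph \<Rightarrow> 'a set set \<Rightarrow> bool" where
  "complete_multipartition B \<P> \<longleftrightarrow> partition_on (pverts B) \<P> \<and>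
     (\<forall>u \<in> pverts B. \<forall>v \<in> pverts B.
        (u, v) \<in> parcs B \<longleftrightarrow> \<not> (\<exists>P \<in> \<P>. u \<in> P \<and> v \<in> P))"

text \<open>A single partite class is allowed; for a block this only concerns the one-vertex graph.\<close>

definition complete_multipartite :: "'a pair_pre_digraph \<Rightarrow> bool" where
  "complete_multipartite B \<longleftrightarrow> (\<exists>\<P>. complete_multipartition B \<P>)"

lemma complete_multipartition_class:
  assumes "complete_multipartition B \<P>" "P \<in> \<P>" "x \<in> P"
  shows "P = {v \<in> pverts B. (x, v) \<notin> parcs B}"
proof -
  have U: "\<Union>\<P> = pverts B" and D: "disjoint \<P>"
    using assms(1) by (auto simp: complete_multipartition_def partition_on_def)
  have E: "(x, v) \<in> parcs B \<longleftrightarrow> \<not> (\<exists>Q \<in> \<P>. x \<in> Q \<and> v \<in> Q)" if "v \<in> pverts B" for v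
    using assms U that by (auto simp: complete_multipartition_def)
  have "Q = P" if "Q \<in> \<P>" "x \<in> Q" for Q
    using D assms that by (auto simp: disjoint_def)
  then show ?thesis using E U assms(2,3) by blast
qed

lemma complete_multipartition_unique:
  assumes "complete_multipartition B \<P>" "complete_multipartition B \<Q>"
  shows "\<P> = \<Q>"
proof -
  have sub: "\<P>' \<subseteq> \<Q>'"
    if c: "complete_multipartition B \<P>'" "complete_multipartition B \<Q>'" for \<P>' \<Q>'
  proof
    fix P assume P: "P \<in> \<P>'"
    then obtain x where x: "x \<in> P"
      using c(1) by (fastforce simp: complete_multipartition_def partition_on_def)
    have "\<Union>\<P>' = \<Union>\<Q>'"
      using c by (simp add: complete_multipartition_def partition_on_def)
    then obtain Q where "Q \<in> \<Q>'" "x \<in> Q" using P x by blast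
    then show "P \<in> \<Q>'"
      using complete_multipartition_class[OF c(1) P x] complete_multipartition_class[OF c(2)] P
      by simp
  qed
  from sub[OF assms] sub[OF assms(2,1)] show ?thesis by blast
qed

text \<open>Well defined on complete multipartite graphs by the uniqueness just proved.\<close>

definition partite_classes :: "'a pair_pre_digraph \<Rightarrow> 'a set set" where
  "partite_classes B = (THE \<P>. complete_multipartition B \<P>)"

definition partite_class :: "'a pair_pre_digraph \<Rightarrow> 'a \<Rightarrow> 'a set" where
  "partite_class B x = (THE P. P \<in> partite_classes B \<and> x \<in> P)"

lemma partite_classes_eqI: "complete_multipartition B \<P> \<Longrightarrow> partite_classes B = \<P>"
  unfolding partite_classes_def by (metis complete_multipartition_unique the_equality)

lemma partite_class_eqI:
  assumes "complete_multipartition B \<P>" "P \<in> \<P>" "x \<in> P"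
  shows "partite_class B x = P"
  unfolding partite_class_def partite_classes_eqI[OF assms(1)]
proof (rule the_equality)
  show "P \<in> \<P> \<and> x \<in> P" using assms by simp
next
  fix Q assume "Q \<in> \<P> \<and> x \<in> Q"
  then have "Q = {v \<in> pverts B. (x, v) \<notin> parcs B}"
    by (intro complete_multipartition_class[OF assms(1)]) simp_all
  moreover have "P = {v \<in> pverts B. (x, v) \<notin> parcs B}"
    by (rule complete_multipartition_class[OF assms])
  ultimately show "Q = P" by simp
qed

definition block_complete_multipartite :: "'a pair_pre_digraph \<Rightarrow> bool" where
  "block_complete_multipartite G \<longleftrightarrow> pair_graph G \<and> connected (with_proj G) \<and>
     (\<forall>B. block G B \<longrightarrow> complete_multipartite B)"

section \<open>Exact-six orientations\<close>

text \<open>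
  An orientation \<open>\<sigma>\<close> maps each block to the set of its short partite classes.  Its value on
  a one-class block (the one-vertex graph) and on non-blocks is immaterial.
\<close>

definition exact_six_orientation ::
    "'a pair_pre_digraph \<Rightarrow> ('a pair_pre_digraph \<Rightarrow> 'a set set) \<Rightarrow> bool" where
  "exact_six_orientation G \<sigma> \<longleftrightarrow>
     (\<forall>B. block G B \<longrightarrow>
        (card (partite_classes B) = 2 \<longrightarrow> (\<exists>P \<in> partite_classes B. \<sigma> B = {P})) \<and>
        (3 \<le> card (partite_classes B) \<longrightarrow>
           \<sigma> B = {P \<in> partite_classes B. \<not> is_singleton P}))"

definition exposed ::
    "'a pair_pre_digraph \<Rightarrow> ('a pair_pre_digraph \<Rightarrow> 'a set set) \<Rightarrow> 'a \<Rightarrow> 'a pair_pre_digraph \<Rightarrow> bool"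
  where
  "exposed G \<sigma> x B \<longleftrightarrow> cutvertex G x \<and> block G B \<and> x \<in> pverts B \<and>
     partite_class B x \<in> \<sigma> B \<and> 2 \<le> card (partite_class B x)"

definition admissible ::
    "'a pair_pre_digraph \<Rightarrow> ('a pair_pre_digraph \<Rightarrow> 'a set set) \<Rightarrow> bool" where
  "admissible G \<sigma> \<longleftrightarrow>
     (\<forall>x. cutvertex G x \<longrightarrow> (\<exists>\<^sub>\<le>\<^sub>1 B. exposed G \<sigma> x B))"

end

theory Submission
  imports Defs
begin

text \<open>
  Hang every vertex \<open>v\<close> of \<open>G\<close> as a leaf from a node of its own, the stub of \<open>v\<close>.  Two leaves
  are then at distance 6 iff their stubs are at distance 4, so it suffices to build a tree through
  the stubs, here called a skeleton, in which every other node has degree at least two.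

  For a single block, take a hub.  If the block has at least three classes, join the hub to one node
  per class and that node to the stubs of the class: stubs are at distance 4 across classes and 2
  within a class.  If it is bipartite, join the hub directly to the stubs of the short class, and by
  paths of length 3 to the stubs of the other one: now the distances are \<open>1 + 3 = 4\<close> across, 2 within
  the short class and 6 within the other class (\<open>skeleton_multipartite\<close>, \<open>skeleton_bipartite\<close>).
  In both cases 4 is attained exactly by adjacent pairs, and 2, the minimum, only inside a short class
  with at least two vertices.

  Blocks that share a cutvertex \<open>x\<close> share the stub of \<open>x\<close>, and distances through it add up.  A pair
  \<open>u, v\<close> on different sides of \<open>x\<close> is not adjacent, and its stubs could be at distance 4 only as
  \<open>2 + 2\<close>; then \<open>x\<close> would lie in a short class with \<open>u\<close> in one block and in a short class with \<open>v\<close>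
  in another one, that is, it would be exposed twice.  This is what admissibility forbids
  (\<open>skeleton_union\<close>).  The skeleton of \<open>G\<close> is therefore obtained by induction: a graph with a
  cutvertex is the union of two smaller graphs with one common vertex, all of whose blocks are blocks
  of \<open>G\<close> (\<open>cutvertex_split\<close>, \<open>block_part\<close>), and a graph without cutvertices is a block of itself.

  Trees are handled together with their distance functions.  The certificate \<open>tree_metric\<close> says that,
  from every root, the levels of adjacent nodes differ by one and every other node has exactly one
  neighbour on the level below.  It survives gluing at a node and adding pendant nodes, and it
  implies that the graph is a tree with the given distances (\<open>undirected_treeI\<close>, \<open>graph_dist_eq\<close>).
\<close>

section \<open>Distance functions of trees\<close>

definition level_function :: "'a set \<Rightarrow> 'a rel \<Rightarrow> 'a \<Rightarrow> ('a \<Rightarrow> nat) \<Rightarrow> bool" where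
  "level_function N E r f \<longleftrightarrow> f r = 0 \<and>
     (\<forall>(a, b) \<in> E. f a = Suc (f b) \<or> f b = Suc (f a)) \<and>
     (\<forall>w \<in> N - {r}. \<exists>!z. (w, z) \<in> E \<and> f w = Suc (f z))"

text \<open>
  All roots are kept at once because two trees are glued at a node that need not be the root of
  either, and because the distances from every leaf are needed in the end.
\<close>

definition tree_metric :: "'a set \<Rightarrow> 'a rel \<Rightarrow> ('a \<Rightarrow> 'a \<Rightarrow> nat) \<Rightarrow> bool" where
  "tree_metric N E d \<longleftrightarrow> finite N \<and> E \<subseteq> N \<times> N \<and> sym E \<and>
     (\<forall>r \<in> N. level_function N E r (d r))"

lemma level_functionD:
  assumes "level_function N E r f"
  shows "f r = 0"
    and "(a, b) \<in> E \<Longrightarrow> f a = Suc (f b) \<or> f b = Suc (f a)"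
    and "w \<in> N \<Longrightarrow> w \<noteq> r \<Longrightarrow> \<exists>z. (w, z) \<in> E \<and> f w = Suc (f z)"
    and "w \<in> N \<Longrightarrow> w \<noteq> r \<Longrightarrow> (w, z) \<in> E \<Longrightarrow> (w, z') \<in> E \<Longrightarrow>
           f w = Suc (f z) \<Longrightarrow> f w = Suc (f z') \<Longrightarrow> z = z'"
  using assms unfolding level_function_def by blast+

lemma level_functionI:
  assumes "f r = 0"
    and "\<And>a b. (a, b) \<in> E \<Longrightarrow> f a = Suc (f b) \<or> f b = Suc (f a)"
    and "\<And>w. w \<in> N \<Longrightarrow> w \<noteq> r \<Longrightarrow> \<exists>z. (w, z) \<in> E \<and> f w = Suc (f z)"
    and "\<And>w z z'. w \<in> N \<Longrightarrow> w \<noteq> r \<Longrightarrow> (w, z) \<in> E \<Longrightarrow> (w, z') \<in> E \<Longrightarrow>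
           f w = Suc (f z) \<Longrightarrow> f w = Suc (f z') \<Longrightarrow> z = z'"
  shows "level_function N E r f"
  unfolding level_function_def using assms(1,2) assms(3,4) by blast

lemma tree_metricD:
  assumes "tree_metric N E d"
  shows "finite N" "E \<subseteq> N \<times> N" "sym E" "r \<in> N \<Longrightarrow> level_function N E r (d r)"
    "r \<in> N \<Longrightarrow> d r r = 0"
  using assms level_functionD(1) unfolding tree_metric_def by fast+

lemma tree_metric_singleton: "tree_metric {c} {} (\<lambda>_ _. 0)"
  by (auto simp: tree_metric_def level_function_def sym_def)

text \<open>
  Seen from a root in the first tree, the second one hangs below \<open>x\<close>: its levels are those from \<open>x\<close>,
  shifted by the level of \<open>x\<close>.
\<close>

lemma level_function_union:
  assumes T1: "tree_metric N1 E1 d1" and T2: "tree_metric N2 E2 d2"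
    and int: "N1 \<inter> N2 = {x}" and r: "r \<in> N1"
    and f: "\<And>w. w \<in> N1 \<Longrightarrow> f w = d1 r w" "\<And>w. w \<in> N2 \<Longrightarrow> f w = d1 r x + d2 x w"
  shows "level_function (N1 \<union> N2) (E1 \<union> E2) r f"
proof -
  have x: "x \<in> N1" "x \<in> N2" using int by auto
  note L1 = level_functionD[OF tree_metricD(4)[OF T1 r]]
  note L2 = level_functionD[OF tree_metricD(4)[OF T2 x(2)]]
  have N1: "a \<in> N1" "b \<in> N1" if "(a, b) \<in> E1" for a b
    using tree_metricD(2)[OF T1] that by auto
  have N2: "a \<in> N2" "b \<in> N2" if "(a, b) \<in> E2" for a b
    using tree_metricD(2)[OF T2] that by auto
  have only_x: "w = x" if "w \<in> N1" "w \<in> N2" for w using int that by auto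
  have up: "d2 x z = 1" if "(x, z) \<in> E2" for z
    using L2(1) L2(2)[OF that] by auto
  \<comment> \<open>The neighbours of x in the second tree lie above x, so x has no second neighbour below it.\<close>
  have E2_up: "w \<noteq> x" if "w \<in> N1 \<union> N2" "(w, z) \<in> E2" "f w = Suc (f z)" for w z
    using up N2[OF that(2)] L2(1) f(2) that by auto
  show ?thesis
  proof (rule level_functionI)
    show "f r = 0" using L1(1) f(1) r by simp
  next
    fix a b assume "(a, b) \<in> E1 \<union> E2"
    then show "f a = Suc (f b) \<or> f b = Suc (f a)"
    proof
      assume e: "(a, b) \<in> E1"
      then show ?thesis using L1(2)[OF e] N1[OF e] f(1) by simp
    next
      assume e: "(a, b) \<in> E2"
      then show ?thesis using L2(2)[OF e] N2[OF e] f(2) by auto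
    qed
  next
    fix w assume w: "w \<in> N1 \<union> N2" "w \<noteq> r"
    show "\<exists>z. (w, z) \<in> E1 \<union> E2 \<and> f w = Suc (f z)"
    proof (cases "w \<in> N1")
      case True
      then obtain z where "(w, z) \<in> E1" "d1 r w = Suc (d1 r z)" using L1(3) w(2) by blast
      then show ?thesis using N1 f(1) by (intro exI[of _ z]) auto
    next
      case False
      then have "w \<in> N2" "w \<noteq> x" using w x by auto
      then obtain z where "(w, z) \<in> E2" "d2 x w = Suc (d2 x z)" using L2(3) by blast
      then show ?thesis using N2 f(2) by (intro exI[of _ z]) auto
    qed
  next
    fix w z z'
    assume w: "w \<in> N1 \<union> N2" "w \<noteq> r" and e: "(w, z) \<in> E1 \<union> E2" "(w, z') \<in> E1 \<union> E2"
      and fz: "f w = Suc (f z)" "f w = Suc (f z')"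
    show "z = z'"
    proof (cases "w \<in> N1")
      case True
      then have e1: "(w, z) \<in> E1" "(w, z') \<in> E1"
        using e E2_up[OF w(1) _ fz(1)] E2_up[OF w(1) _ fz(2)] N2 only_x by blast+
      have "f w = d1 r w" "f z = d1 r z" "f z' = d1 r z'" using N1 e1 f(1) by auto
      then show ?thesis using L1(4)[OF True w(2) e1] fz by simp
    next
      case False
      then have e2: "(w, z) \<in> E2" "(w, z') \<in> E2" and w': "w \<in> N2" "w \<noteq> x"
        using e N1 w(1) x by blast+
      have "f w = d1 r x + d2 x w" "f z = d1 r x + d2 x z" "f z' = d1 r x + d2 x z'"
        using N2 e2 f(2) by auto
      then show ?thesis using L2(4)[OF w' e2] fz by simp
    qed
  qed
qed

text \<open>
  A walk between the two sides has to pass through the common node, so distances through it add up.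
\<close>

lemma tree_metric_union:
  assumes T1: "tree_metric N1 E1 d1" and T2: "tree_metric N2 E2 d2"
    and int: "N1 \<inter> N2 = {x}"
  shows "\<exists>d. tree_metric (N1 \<union> N2) (E1 \<union> E2) d \<and>
    (\<forall>u \<in> N1. \<forall>v \<in> N1. d u v = d1 u v) \<and> (\<forall>u \<in> N2. \<forall>v \<in> N2. d u v = d2 u v) \<and>
    (\<forall>u \<in> N1. \<forall>v \<in> N2. d u v = d1 u x + d2 x v) \<and> (\<forall>u \<in> N2. \<forall>v \<in> N1. d u v = d2 u x + d1 x v)"
proof -
  have x: "x \<in> N1" "x \<in> N2" using int by auto
  have only_x: "w = x" if "w \<in> N1" "w \<in> N2" for w using int that by auto
  have z: "d1 x x = 0" "d2 x x = 0" using tree_metricD(5) T1 T2 x by fast+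
  define d where "d u v =
    (if u \<in> N1 \<and> v \<in> N1 then d1 u v else if u \<in> N2 \<and> v \<in> N2 then d2 u v
     else if u \<in> N1 then d1 u x + d2 x v else d2 u x + d1 x v)" for u v
  have d: "u \<in> N1 \<Longrightarrow> v \<in> N1 \<Longrightarrow> d u v = d1 u v"
    "u \<in> N2 \<Longrightarrow> v \<in> N2 \<Longrightarrow> d u v = d2 u v"
    "u \<in> N1 \<Longrightarrow> v \<in> N2 \<Longrightarrow> d u v = d1 u x + d2 x v"
    "u \<in> N2 \<Longrightarrow> v \<in> N1 \<Longrightarrow> d u v = d2 u x + d1 x v" for u v
    using only_x[of u] only_x[of v] x z by (auto simp: d_def)
  have "level_function (N1 \<union> N2) (E1 \<union> E2) r (d r)" if "r \<in> N1 \<union> N2" for r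
  proof (cases "r \<in> N1")
    case True
    then show ?thesis using d by (intro level_function_union[OF T1 T2 int]) auto
  next
    case False
    then have "r \<in> N2" using that by simp
    moreover have "N2 \<inter> N1 = {x}" using int by auto
    ultimately have "level_function (N2 \<union> N1) (E2 \<union> E1) r (d r)"
      using d by (intro level_function_union[OF T2 T1]) auto
    then show ?thesis by (simp add: Un_commute)
  qed
  moreover have "sym (E1 \<union> E2)"
    using tree_metricD(3)[OF T1] tree_metricD(3)[OF T2] by (rule sym_Un)
  ultimately have "tree_metric (N1 \<union> N2) (E1 \<union> E2) d"
    using tree_metricD(1,2)[OF T1] tree_metricD(1,2)[OF T2] unfolding tree_metric_def by blast
  then show ?thesis using d by blast
qed

definition pendants :: "'a set \<Rightarrow> ('a \<Rightarrow> 'a) \<Rightarrow> 'a rel" where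
  "pendants S q = (\<lambda>s. (s, q s)) ` S \<union> (\<lambda>s. (q s, s)) ` S"

lemma pendants_iff: "(a, b) \<in> pendants S q \<longleftrightarrow> a \<in> S \<and> b = q a \<or> b \<in> S \<and> a = q b"
  by (auto simp: pendants_def)

lemma tree_metric_pendants:
  assumes T: "tree_metric N E d" and S: "finite S" "S \<inter> N = {}" and q: "q ` S \<subseteq> N"
  shows "\<exists>d'. tree_metric (N \<union> S) (E \<union> pendants S q) d' \<and>
    (\<forall>u \<in> N. \<forall>v \<in> N. d' u v = d u v) \<and> (\<forall>s \<in> S. \<forall>v \<in> N. d' s v = d (q s) v + 1) \<and>
    (\<forall>u \<in> N. \<forall>s \<in> S. d' u s = d u (q s) + 1) \<and>
    (\<forall>s \<in> S. \<forall>t \<in> S. s \<noteq> t \<longrightarrow> d' s t = d (q s) (q t) + 2)"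
proof -
  \<comment> \<open>Each new node is replaced by its attachment node, at an extra cost of one.  The case u = v is
    separate: the formula would give the length 2 of the walk to the attachment node and back.\<close>
  define b where "b w = (if w \<in> S then q w else w)" for w
  define h :: "'a \<Rightarrow> nat" where "h w = (if w \<in> S then 1 else 0)" for w
  define d' where "d' u v = (if u = v then 0 else h u + h v + d (b u) (b v))" for u v
  have NS: "w \<in> N \<Longrightarrow> w \<notin> S" for w using S(2) by auto
  have z: "w \<in> N \<Longrightarrow> d w w = 0" for w using tree_metricD(5)[OF T] .
  have d: "u \<in> N \<Longrightarrow> v \<in> N \<Longrightarrow> d' u v = d u v"
    "s \<in> S \<Longrightarrow> v \<in> N \<Longrightarrow> d' s v = d (q s) v + 1"
    "u \<in> N \<Longrightarrow> s \<in> S \<Longrightarrow> d' u s = d u (q s) + 1"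
    "s \<in> S \<Longrightarrow> t \<in> S \<Longrightarrow> s \<noteq> t \<Longrightarrow> d' s t = d (q s) (q t) + 2"
    for u v s t using NS z by (auto simp: d'_def b_def h_def)
  have d0: "d' s s = 0" for s by (simp add: d'_def)
  have EN: "a \<in> N" "b \<in> N" if "(a, b) \<in> E" for a b
    using tree_metricD(2)[OF T] that by auto
  have q': "s \<in> S \<Longrightarrow> q s \<in> N" for s using q by auto
  let ?E = "E \<union> pendants S q"
  have E: "(u, v) \<in> ?E \<longleftrightarrow> (u, v) \<in> E \<or> u \<in> S \<and> v = q u \<or> v \<in> S \<and> u = q v" for u v
    by (auto simp: pendants_iff)
  have step: "d' r s = Suc (d' r (q s))" if "r \<in> N \<union> S" "s \<in> S" "r \<noteq> s" for r s
    using that d q' NS by auto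
  have level: "level_function (N \<union> S) ?E r (d' r)" if r: "r \<in> N \<union> S" for r
  proof -
    have br: "b r \<in> N" using r q' by (auto simp: b_def)
    have dr: "d' r w = h r + d (b r) w" if "w \<in> N" for w
      using r that d NS by (auto simp: b_def h_def)
    note L = level_functionD[OF tree_metricD(4)[OF T br]]
    show ?thesis
    proof (rule level_functionI)
      show "d' r r = 0" by (rule d0)
    next
      fix u v assume "(u, v) \<in> ?E"
      then consider "(u, v) \<in> E" | "u \<in> S" "v = q u" | "v \<in> S" "u = q v" using E by blast
      then show "d' r u = Suc (d' r v) \<or> d' r v = Suc (d' r u)"
      proof cases
        case 1
        then show ?thesis using L(2)[OF 1] EN[OF 1] dr by auto
      next
        case 2
        then show ?thesis
          using step[OF r 2(1)] d(2)[of u v] d0 z q' by (cases "r = u") auto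
      next
        case 3
        then show ?thesis
          using step[OF r 3(1)] d(2)[of v u] d0 z q' by (cases "r = v") auto
      qed
    next
      fix w assume w: "w \<in> N \<union> S" "w \<noteq> r"
      \<comment> \<open>In the third case the root is a new node and w is its only neighbour.\<close>
      consider "w \<in> S" | "w \<in> N" "w \<noteq> b r" | "w \<in> N" "w = b r" using w by blast
      then show "\<exists>v. (w, v) \<in> ?E \<and> d' r w = Suc (d' r v)"
      proof cases
        case 1
        then show ?thesis using step[OF r 1] w(2) E by blast
      next
        case 2
        then obtain v where "(w, v) \<in> E" "d (b r) w = Suc (d (b r) v)" using L(3) by blast
        then show ?thesis using dr 2(1) EN by (intro exI[of _ v]) auto
      next
        case 3
        then have "r \<in> S" "w = q r" using w by (auto simp: b_def split: if_splits)
        then show ?thesis using d(2)[of r w] d0 z 3(1) E by (intro exI[of _ r]) auto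
      qed
    next
      fix w v v'
      assume w: "w \<in> N \<union> S" "w \<noteq> r" and e: "(w, v) \<in> ?E" "(w, v') \<in> ?E"
        and f: "d' r w = Suc (d' r v)" "d' r w = Suc (d' r v')"
      consider "w \<in> S" | "w \<in> N" "w \<noteq> b r" | "w \<in> N" "w = b r" using w by blast
      then show "v = v'"
      proof cases
        case 1
        then show ?thesis using e E NS EN q' by metis
      next
        case 2
        have "(w, y) \<in> E" if y: "(w, y) \<in> ?E" "d' r w = Suc (d' r y)" for y
        proof (rule ccontr)
          assume "(w, y) \<notin> E"
          then have y': "y \<in> S" "w = q y" using E y(1) NS 2(1) by blast+
          then have "r = y" using step[OF r, of y] y(2) by fastforce
          then show False using y' 2 by (simp add: b_def)
        qed
        then have e': "(w, v) \<in> E" "(w, v') \<in> E" using e f by blast+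
        show ?thesis using L(4)[OF 2 e'] f dr EN[OF e'(1)] EN[OF e'(2)] by simp
      next
        case 3
        then have rS: "r \<in> S" "w = q r" using w by (auto simp: b_def split: if_splits)
        have "y = r" if y: "(w, y) \<in> ?E" "d' r w = Suc (d' r y)" for y
        proof -
          have "d' r w = 1" using d(2)[of r w] rS z 3(1) by simp
          then have "d' r y = 0" using y(2) by simp
          moreover have "y \<in> N \<or> y \<in> S" using y(1) E EN q' by blast
          ultimately show ?thesis using rS(1) d(2)[of r y] d(4)[of r y] by (cases "y = r") auto
        qed
        then show ?thesis using e f by metis
      qed
    qed
  qed
  moreover have "finite (N \<union> S)" "?E \<subseteq> (N \<union> S) \<times> (N \<union> S)"
    using tree_metricD(1,2)[OF T] S(1) q' by (auto simp: pendants_def)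
  moreover have "sym ?E"
    using tree_metricD(3)[OF T] unfolding sym_def E by blast
  ultimately have "tree_metric (N \<union> S) ?E d'"
    unfolding tree_metric_def by blast
  then show ?thesis using d by blast
qed

lemma tree_metric_image:
  assumes T: "tree_metric N E d" and g: "inj_on g N"
  shows "\<exists>d'. tree_metric (g ` N) (map_prod g g ` E) d' \<and>
    (\<forall>u \<in> N. \<forall>v \<in> N. d' (g u) (g v) = d u v)"
proof -
  define d' where "d' u v = d (inv_into N g u) (inv_into N g v)" for u v
  have d': "d' (g u) (g v) = d u v" if "u \<in> N" "v \<in> N" for u v
    using that g by (simp add: d'_def)
  have EN: "a \<in> N" "b \<in> N" if "(a, b) \<in> E" for a b
    using tree_metricD(2)[OF T] that by auto
  have E: "(g u, y) \<in> map_prod g g ` E \<longleftrightarrow> (\<exists>v. y = g v \<and> (u, v) \<in> E)" if "u \<in> N" for u y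
    using EN that g by (fastforce dest: inj_onD)
  have "level_function (g ` N) (map_prod g g ` E) (g r) (d' (g r))" if r: "r \<in> N" for r
  proof -
    note L = level_functionD[OF tree_metricD(4)[OF T r]]
    show ?thesis
    proof (rule level_functionI)
      show "d' (g r) (g r) = 0" using d' r L(1) by simp
    next
      fix a b assume "(a, b) \<in> map_prod g g ` E"
      then obtain u v where "(u, v) \<in> E" "a = g u" "b = g v" by auto
      then show "d' (g r) a = Suc (d' (g r) b) \<or> d' (g r) b = Suc (d' (g r) a)"
        using d' r L(2) EN by auto
    next
      fix w assume "w \<in> g ` N" "w \<noteq> g r"
      then obtain u where u: "u \<in> N" "w = g u" "u \<noteq> r" by auto
      then obtain z where "(u, z) \<in> E" "d r u = Suc (d r z)" using L(3) by blast
      then show "\<exists>z. (w, z) \<in> map_prod g g ` E \<and> d' (g r) w = Suc (d' (g r) z)"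
        using u d' r EN by (intro exI[of _ "g z"]) auto
    next
      fix w z z' assume w: "w \<in> g ` N" "w \<noteq> g r"
        and e: "(w, z) \<in> map_prod g g ` E" "(w, z') \<in> map_prod g g ` E"
        and f: "d' (g r) w = Suc (d' (g r) z)" "d' (g r) w = Suc (d' (g r) z')"
      from w obtain u where u: "u \<in> N" "w = g u" "u \<noteq> r" by auto
      from e obtain v v' where v: "z = g v" "(u, v) \<in> E" "z' = g v'" "(u, v') \<in> E"
        unfolding u(2) E[OF u(1)] by metis
      have "d r u = Suc (d r v)" "d r u = Suc (d r v')"
        using f d' r EN v u by simp_all
      then have "v = v'" by (rule L(4)[OF u(1,3) v(2,4)])
      then show "z = z'" using v by simp
    qed
  qed
  moreover have "sym (map_prod g g ` E)"
    using tree_metricD(3)[OF T] unfolding sym_def by force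
  ultimately have "tree_metric (g ` N) (map_prod g g ` E) d'"
    using tree_metricD(1,2)[OF T] unfolding tree_metric_def by auto
  then show ?thesis using d' by blast
qed

section \<open>Trees from their distance functions\<close>

lemma pair_graph_iff:
  "pair_graph G \<longleftrightarrow> finite (pverts G) \<and> parcs G \<subseteq> pverts G \<times> pverts G \<and> sym (parcs G) \<and>
     (\<forall>v. (v, v) \<notin> parcs G)"
proof
  assume "pair_graph G"
  then interpret pair_graph G .
  show "finite (pverts G) \<and> parcs G \<subseteq> pverts G \<times> pverts G \<and> sym (parcs G) \<and> (\<forall>v. (v, v) \<notin> parcs G)"
    using pair_finite_verts in_arcsD1 in_arcsD2 arcs_symmetric no_loops'
    unfolding sym_def by fast
next
  assume G: "finite (pverts G) \<and> parcs G \<subseteq> pverts G \<times> pverts G \<and> sym (parcs G) \<and>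
     (\<forall>v. (v, v) \<notin> parcs G)"
  then have "finite (parcs G)" by (meson finite_SigmaI rev_finite_subset)
  with G show "pair_graph G"
    by unfold_locales (auto simp: symmetric_def)
qed

lemma rtrancl_on_eq_rtrancl:
  assumes "E \<subseteq> V \<times> V" "u \<in> V"
  shows "(u, v) \<in> rtrancl_on V E \<longleftrightarrow> (u, v) \<in> E\<^sup>*"
proof
  assume "(u, v) \<in> E\<^sup>*"
  then show "(u, v) \<in> rtrancl_on V E"
    by induct (use assms in \<open>auto intro: rtrancl_on_into_rtrancl_on\<close>)
qed (rule rtrancl_on_rtranclI)

lemma connected_iff:
  assumes "pair_graph G"
  shows "connected (with_proj G) \<longleftrightarrow>
    pverts G \<noteq> {} \<and> (\<forall>u \<in> pverts G. \<forall>v \<in> pverts G. (u, v) \<in> (parcs G)\<^sup>*)"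
proof -
  have "parcs G \<subseteq> pverts G \<times> pverts G" "(parcs G)\<^sup>s = parcs G"
    using assms by (auto simp: pair_graph_iff symcl_def dest: symD)
  then show ?thesis by (auto simp: connected_conv rtrancl_on_eq_rtrancl)
qed

text \<open>
  Connectedness: descend level by level to the root.  No cycles: a node of highest level on a cycle of
  length at least 3 has two different neighbours on the cycle, and both would be its unique neighbour
  on the level below.
\<close>

lemma undirected_treeI:
  assumes T: "tree_metric (pverts T) (parcs T) d" and ne: "pverts T \<noteq> {}"
  shows "undirected_tree T"
proof -
  have E: "parcs T \<subseteq> pverts T \<times> pverts T" using tree_metricD(2)[OF T] .
  obtain r where r: "r \<in> pverts T" using ne by auto
  note L = level_functionD[OF tree_metricD(4)[OF T r]]
  have "(v, v) \<notin> parcs T" for v using L(2) by fastforce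
  then have G: "pair_graph T"
    using tree_metricD(1-3)[OF T] by (simp add: pair_graph_iff)
  then interpret pair_graph T .
  have "(w, u) \<in> (parcs T)\<^sup>*" if u: "u \<in> pverts T" and w: "w \<in> pverts T" for u w
    using w
  proof (induct "d u w" arbitrary: w rule: less_induct)
    case less
    show ?case
    proof (cases "w = u")
      case False
      then obtain z where z: "(w, z) \<in> parcs T" "d u w = Suc (d u z)"
        using level_functionD(3)[OF tree_metricD(4)[OF T u] less(2)] by blast
      then have "(z, u) \<in> (parcs T)\<^sup>*" using less E by auto
      then show ?thesis using z(1) by (meson converse_rtrancl_into_rtrancl)
    qed simp
  qed
  then have "connected (with_proj T)" using ne by (simp add: connected_iff[OF G])
  moreover have "\<not> 3 \<le> length p" if cyc: "cycle p" for p
  proof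
    assume len: "3 \<le> length p"
    define n where "n = length p"
    from cyc obtain u where aw: "awalk u p u" and dist: "distinct (tl (pawalk_verts u p))" and "p \<noteq> []"
      by (auto simp: cycle_def)
    have cas: "pcas u p u" and arcs: "set p \<subseteq> parcs T" using aw by auto
    \<comment> \<open>A cycle is a list of arcs with distinct heads in which each arc ends where its cyclic
      successor starts; its nodes are the heads.\<close>
    have "pawalk_verts u p = fst (hd p) # map snd p"
      using awalk_verts_conv'[OF cas] \<open>p \<noteq> []\<close> by simp
    then have dist: "distinct (map snd p)" using dist by simp
    have consecutive: "snd (q ! i) = fst (q ! Suc i)"
      if "pcas a q b" "Suc i < length q" for a b i and q :: "('a \<times> 'a) list"
      using that
    proof (induct q arbitrary: a i)
      case (Cons e q)
      then show ?case by (cases q; cases i) auto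
    qed simp
    have ends: "fst (hd q) = a \<and> snd (last q) = b"
      if "pcas a q b" "q \<noteq> []" for a b and q :: "('a \<times> 'a) list"
      using that
    proof (induct q arbitrary: a)
      case (Cons e q)
      then show ?case by (cases q) auto
    qed simp
    have closing: "snd (last p) = fst (hd p)" using ends[OF cas \<open>p \<noteq> []\<close>] by simp
    have succ: "snd (p ! i) = fst (p ! (Suc i mod n))" if "i < n" for i
    proof (cases "Suc i < n")
      case True
      then show ?thesis using consecutive[OF cas] n_def by simp
    next
      case False
      then have "Suc i = n" using that by simp
      then have "i = n - 1" "Suc i mod n = 0" by auto
      then show ?thesis
        using closing \<open>p \<noteq> []\<close> by (simp add: last_conv_nth hd_conv_nth n_def)
    qed
    have e: "p ! i \<in> parcs T" if "i < n" for i using arcs that n_def by auto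
    define M where "M = Max ((\<lambda>i. d r (snd (p ! i))) ` {..<n})"
    have "M \<in> (\<lambda>i. d r (snd (p ! i))) ` {..<n}"
      unfolding M_def by (rule Max_in) (use len n_def in \<open>auto simp: lessThan_empty_iff\<close>)
    then obtain i where i: "i < n" "d r (snd (p ! i)) = M" by auto
    have max: "d r (snd (p ! j)) \<le> M" if "j < n" for j
      unfolding M_def using that by auto
    \<comment> \<open>The cyclic successor and predecessor of i; they differ because the length exceeds 2.\<close>
    define j where "j = Suc i mod n"
    have j: "j < n" "j \<noteq> i" using i(1) len n_def by (auto simp: j_def mod_Suc)
    define k where "k = (i + n - 1) mod n"
    have k: "k < n" using i(1) by (simp add: k_def)
    have ki: "Suc k mod n = i" using i(1) by (simp add: k_def mod_Suc_eq)
    have kj: "k \<noteq> j"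
    proof
      assume "k = j"
      then have "Suc (Suc i mod n) mod n = i" using ki j_def by simp
      then show False using i(1) len n_def by (auto simp: mod_Suc split: if_splits)
    qed
    define w where "w = snd (p ! i)"
    have w: "w \<in> pverts T" using e[OF i(1)] E unfolding w_def by auto
    have "(fst (p ! i), w) \<in> parcs T" using e[OF i(1)] by (simp add: w_def)
    then have e1: "(w, snd (p ! k)) \<in> parcs T"
      using succ[OF k] ki arcs_symmetric by simp
    have e2: "(w, snd (p ! j)) \<in> parcs T"
      using e[OF j(1)] succ[OF i(1)] unfolding w_def j_def[symmetric] by simp
    have lower: "d r w = Suc (d r x)" if "(w, x) \<in> parcs T" "d r x \<le> M" for x
      using L(2)[OF that(1)] that(2) i(2) w_def by simp
    have "w \<noteq> r" using lower[OF e1 max[OF k]] L(1) by auto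
    then have "snd (p ! k) = snd (p ! j)"
      using L(4)[OF w _ e1 e2] lower[OF e1 max[OF k]] lower[OF e2 max[OF j(1)]] by simp
    then show False
      using dist k j(1) kj n_def by (auto simp: distinct_conv_nth)
  qed
  ultimately show ?thesis unfolding undirected_tree_def using G by blast
qed

text \<open>
  Along a walk the level rises by at most one per arc, and the descent to the root, read backwards, is
  a walk that attains this bound.
\<close>

lemma graph_dist_eq:
  assumes T: "tree_metric (pverts T) (parcs T) d" and u: "u \<in> pverts T" and v: "v \<in> pverts T"
  shows "graph_dist T u v = ereal (real (d u v))"
proof -
  have "undirected_tree T" using undirected_treeI[OF T] u by auto
  then interpret pair_graph T by (simp add: undirected_tree_def)
  note L = level_functionD[OF tree_metricD(4)[OF T u]]
  have cost: "awalk_cost (\<lambda>_. 1) p = real (length p)" for p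
    by (induct p) auto
  have "\<exists>p. awalk u p v \<and> length p = d u v"
    using v
  proof (induct "d u v" arbitrary: v rule: less_induct)
    case less
    show ?case
    proof (cases "v = u")
      case True
      then show ?thesis using L(1) u by (auto simp: awalk_Nil_iff)
    next
      case False
      then obtain z where z: "(v, z) \<in> parcs T" "d u v = Suc (d u z)"
        using L(3) less(2) by blast
      then obtain p where "awalk u p z" "length p = d u z" using less(1)[of z] in_arcsD2 by auto
      moreover have "awalk z [(z, v)] v"
        using arc_implies_awalk[of "(z, v)"] arcs_symmetric[OF z(1)] by simp
      ultimately have "awalk u (p @ [(z, v)]) v" "length (p @ [(z, v)]) = d u v"
        using awalk_appendI[of u p z] z(2) by auto
      then show ?thesis by blast
    qed
  qed
  then obtain p where "awalk u p v" "length p = d u v" by blast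
  then have "\<mu> (\<lambda>_. 1) u v \<le> ereal (real (d u v))"
    using min_cost_le_walk_cost[of u p v "\<lambda>_. 1"] cost by simp
  moreover have "d u y \<le> d u x + length p" if "awalk x p y" for p x y
    using that
  proof (induct p arbitrary: x)
    case Nil
    then show ?case by (simp add: awalk_Nil_iff)
  next
    case (Cons e p)
    then have "e \<in> parcs T" "x = fst e" "awalk (snd e) p y" by (auto simp: awalk_Cons_iff)
    moreover from this have "d u (snd e) \<le> d u x + 1" using L(2)[of x "snd e"] by auto
    ultimately show ?case using Cons(1)[of "snd e"] by simp
  qed
  then have "d u v \<le> length p" if "awalk u p v" for p using that L(1) by fastforce
  then have "ereal (real (d u v)) \<le> \<mu> (\<lambda>_. 1) u v"
    unfolding \<mu>_def by (intro INF_greatest) (simp add: cost)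
  ultimately show ?thesis unfolding graph_dist_def by (intro antisym)
qed

section \<open>Cutting a graph at a cutvertex\<close>

text \<open>
  The arcs that survive the deletion of \<open>v\<close>.  With plain relations in place of the library's
  graphs and reachability, walks can be handled by induction over \<open>rtrancl\<close>.
\<close>

definition arcs_avoiding :: "'a rel \<Rightarrow> 'a \<Rightarrow> 'a rel" where
  "arcs_avoiding E v = {(a, b) \<in> E. a \<noteq> v \<and> b \<noteq> v}"

lemma cutvertex_iff:
  assumes G: "pair_graph G"
  shows "cutvertex G v \<longleftrightarrow> v \<in> pverts G \<and> (\<exists>a \<in> pverts G - {v}. \<exists>b \<in> pverts G - {v}.
    (a, b) \<in> (parcs G)\<^sup>* \<and> (a, b) \<notin> (arcs_avoiding (parcs G) v)\<^sup>*)"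
proof -
  interpret pair_graph G by (rule G)
  have E: "parcs G \<subseteq> pverts G \<times> pverts G" using G by (simp add: pair_graph_iff)
  have "arcs_ends (del_vert v) = arcs_avoiding (parcs G) v"
    by (auto simp: arcs_ends_conv del_vert_simps arcs_avoiding_def)
  moreover have "arcs_avoiding (parcs G) v \<subseteq> (pverts G - {v}) \<times> (pverts G - {v})"
    using E by (auto simp: arcs_avoiding_def)
  ultimately have "a \<rightarrow>\<^sup>*\<^bsub>del_vert v\<^esub> b \<longleftrightarrow> (a, b) \<in> (arcs_avoiding (parcs G) v)\<^sup>*"
    if "a \<in> pverts G - {v}" for a b
    using that by (simp add: reachable_def rtrancl_on_eq_rtrancl del_vert_simps)
  moreover have "a \<rightarrow>\<^sup>*\<^bsub>with_proj G\<^esub> b \<longleftrightarrow> (a, b) \<in> (parcs G)\<^sup>*"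
    if "a \<in> pverts G - {v}" for a b
    using that E by (simp add: reachable_def rtrancl_on_eq_rtrancl)
  ultimately show ?thesis unfolding cutvertex_def by blast
qed

lemma subgraph_iff:
  assumes "pair_graph H" "pair_graph G"
  shows "subgraph (with_proj H) (with_proj G) \<longleftrightarrow> pverts H \<subseteq> pverts G \<and> parcs H \<subseteq> parcs G"
proof -
  interpret H: pair_graph H by fact
  interpret G: pair_graph G by fact
  show ?thesis using H.wf_digraph G.wf_digraph by (auto simp: subgraph_def compatible_def)
qed

definition connected_graph :: "'a pair_pre_digraph \<Rightarrow> bool" where
  "connected_graph G \<longleftrightarrow> pair_graph G \<and> connected (with_proj G)"

lemma connected_graphD:
  assumes "connected_graph G"
  shows "pair_graph G" "pverts G \<noteq> {}" "finite (pverts G)" "parcs G \<subseteq> pverts G \<times> pverts G"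
    "sym (parcs G)" "(v, v) \<notin> parcs G"
    "a \<in> pverts G \<Longrightarrow> b \<in> pverts G \<Longrightarrow> (a, b) \<in> (parcs G)\<^sup>*"
  using assms by (auto simp: connected_graph_def pair_graph_iff connected_iff)

lemma connected_graph_neighbour:
  assumes "connected_graph G" "a \<in> pverts G" "b \<in> pverts G" "a \<noteq> b"
  obtains c where "(a, c) \<in> parcs G" "c \<in> pverts G" "c \<noteq> a"
proof -
  have "(a, b) \<in> (parcs G)\<^sup>*" using connected_graphD(7)[OF assms(1-3)] .
  then obtain c where "(a, c) \<in> parcs G" using assms(4) by (auto elim: converse_rtranclE)
  then show ?thesis using that connected_graphD(4,6)[OF assms(1)] by blast
qed

lemma nonseparable_iff:
  "nonseparable B \<longleftrightarrow> connected_graph B \<and> (\<forall>v. \<not> cutvertex B v)"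
  by (auto simp: nonseparable_def connected_graph_def)

lemma block_iff:
  assumes G: "pair_graph G"
  shows "block G B \<longleftrightarrow> nonseparable B \<and> pverts B \<subseteq> pverts G \<and> parcs B \<subseteq> parcs G \<and>
     (\<forall>B'. nonseparable B' \<and> pverts B' \<subseteq> pverts G \<and> parcs B' \<subseteq> parcs G \<and>
           pverts B \<subseteq> pverts B' \<and> parcs B \<subseteq> parcs B' \<longrightarrow> B' = B)"
  unfolding block_def using subgraph_iff nonseparable_iff connected_graphD(1) G by metis

lemma block_self:
  assumes "connected_graph G" "\<And>v. \<not> cutvertex G v"
  shows "block G G"
  unfolding block_iff[OF connected_graphD(1)[OF assms(1)]] nonseparable_iff
  using assms by (auto intro!: pair_pre_digraph.equality)

lemma nonseparable_edge:
  assumes "x \<noteq> y"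
  shows "nonseparable \<lparr>pverts = {x, y}, parcs = {(x, y), (y, x)}\<rparr>" (is "nonseparable ?K")
proof -
  have G: "pair_graph ?K" using assms by (auto simp: pair_graph_iff sym_def)
  then have "connected_graph ?K" by (auto simp: connected_graph_def connected_iff)
  moreover have "\<not> cutvertex ?K v" for v
    unfolding cutvertex_iff[OF G] by auto
  ultimately show ?thesis by (simp add: nonseparable_iff)
qed

text \<open>
  A connected graph cut at a vertex \<open>x\<close> into two graphs.  The situation is symmetric, so every result
  on \<open>G1\<close> also holds for \<open>G2\<close> by \<open>flip\<close>.
\<close>

locale one_point_union =
  fixes G G1 G2 :: "'a pair_pre_digraph" and x :: 'a
  assumes graph: "connected_graph G" "pair_graph G1" "pair_graph G2"
    and verts: "pverts G = pverts G1 \<union> pverts G2" "pverts G1 \<inter> pverts G2 = {x}"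
    and arcs: "parcs G = parcs G1 \<union> parcs G2"
begin

lemma flip: "one_point_union G G2 G1 x"
  using graph verts arcs unfolding one_point_union_def by auto

lemma arcs_in:
  "parcs G1 \<subseteq> pverts G1 \<times> pverts G1" "parcs G2 \<subseteq> pverts G2 \<times> pverts G2"
  using graph by (simp_all add: pair_graph_iff)

lemma arc_ends:
  "(u, v) \<in> parcs G1 \<Longrightarrow> u \<in> pverts G1 \<and> v \<in> pverts G1"
  "(u, v) \<in> parcs G2 \<Longrightarrow> u \<in> pverts G2 \<and> v \<in> pverts G2"
  using arcs_in by auto

lemma x_in: "x \<in> pverts G1" "x \<in> pverts G2"
  using verts by auto

text \<open>
  Collapsing the second graph to \<open>x\<close> turns walks of \<open>G\<close> into walks of \<open>G1\<close>, and those that avoid a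
  vertex \<open>v\<close> into such walks: an arc of \<open>G2\<close> disappears.  Hence \<open>G1\<close> is connected, and the
  cutvertices of \<open>G1\<close> are cutvertices of \<open>G\<close>.
\<close>

definition retract :: "'a \<Rightarrow> 'a" where
  "retract w = (if w \<in> pverts G1 then w else x)"

lemma retract_simps [simp]:
  "w \<in> pverts G1 \<Longrightarrow> retract w = w" "w \<in> pverts G2 \<Longrightarrow> retract w = x"
  using verts by (auto simp: retract_def)

lemma retract_walk:
  assumes "(a, b) \<in> (parcs G)\<^sup>*"
  shows "(retract a, retract b) \<in> (parcs G1)\<^sup>*"
  using assms
proof induct
  case (step b c)
  then have "(retract b, retract c) \<in> (parcs G1)\<^sup>*" using arcs_in arcs by auto
  then show ?case using step(3) by simp
qed simp

lemma retract_walk_avoiding: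
  assumes "(a, b) \<in> (arcs_avoiding (parcs G) v)\<^sup>*"
  shows "(retract a, retract b) \<in> (arcs_avoiding (parcs G1) v)\<^sup>*"
  using assms
proof induct
  case (step b c)
  then consider "(b, c) \<in> arcs_avoiding (parcs G1) v" | "(b, c) \<in> parcs G2"
    using arcs by (auto simp: arcs_avoiding_def)
  then have "(retract b, retract c) \<in> (arcs_avoiding (parcs G1) v)\<^sup>*"
  proof cases
    case 1
    then have "b \<in> pverts G1" "c \<in> pverts G1" using arcs_in by (auto simp: arcs_avoiding_def)
    then show ?thesis using 1 by simp
  next
    case 2
    then show ?thesis using arcs_in by auto
  qed
  then show ?case using step(3) by simp
qed simp

text \<open>
  Retraction would make a walk that avoids \<open>x\<close> into a walk that avoids \<open>x\<close> but ends there.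
\<close>

lemma separated:
  assumes "a \<in> pverts G1 - {x}" "b \<in> pverts G2"
  shows "(a, b) \<notin> (arcs_avoiding (parcs G) x)\<^sup>*"
proof
  assume "(a, b) \<in> (arcs_avoiding (parcs G) x)\<^sup>*"
  then have "(a, x) \<in> (arcs_avoiding (parcs G1) x)\<^sup>*" using retract_walk_avoiding[of a b x] assms by simp
  then show False using assms(1) by (auto simp: arcs_avoiding_def elim: rtranclE)
qed

lemma cutvertex_x:
  assumes "a \<in> pverts G1 - {x}" "b \<in> pverts G2 - {x}"
  shows "cutvertex G x"
proof -
  have "x \<in> pverts G" "a \<in> pverts G - {x}" "b \<in> pverts G - {x}"
    using assms verts x_in by auto
  moreover from this have "(a, b) \<in> (parcs G)\<^sup>*" using connected_graphD(7)[OF graph(1)] by blast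
  moreover have "(a, b) \<notin> (arcs_avoiding (parcs G) x)\<^sup>*" using separated assms by blast
  ultimately show ?thesis
    unfolding cutvertex_iff[OF connected_graphD(1)[OF graph(1)]] by blast
qed

lemma connected_part: "connected_graph G1"
proof -
  have "(a, b) \<in> (parcs G1)\<^sup>*" if "a \<in> pverts G1" "b \<in> pverts G1" for a b
    using retract_walk[OF connected_graphD(7)[OF graph(1), of a b]] that verts by simp
  then show ?thesis using graph(2) x_in by (auto simp: connected_graph_def connected_iff)
qed

lemma cutvertex_part:
  assumes "cutvertex G1 v"
  shows "cutvertex G v"
proof -
  obtain a b where ab: "v \<in> pverts G1" "a \<in> pverts G1 - {v}" "b \<in> pverts G1 - {v}"
    "(a, b) \<notin> (arcs_avoiding (parcs G1) v)\<^sup>*"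
    using assms unfolding cutvertex_iff[OF graph(2)] by blast
  then have "(a, b) \<notin> (arcs_avoiding (parcs G) v)\<^sup>*" using retract_walk_avoiding[of a b v] by auto
  moreover have "(a, b) \<in> (parcs G)\<^sup>*"
    using ab connected_graphD(7)[OF graph(1)] verts by blast
  ultimately show ?thesis
    unfolding cutvertex_iff[OF connected_graphD(1)[OF graph(1)]] using ab verts by blast
qed

text \<open>
  A connected subgraph with vertices strictly on both sides has \<open>x\<close> as a cutvertex.
\<close>

lemma nonseparable_on_one_side:
  assumes B: "nonseparable B" and sub: "pverts B \<subseteq> pverts G" "parcs B \<subseteq> parcs G"
  shows "pverts B \<subseteq> pverts G1 \<or> pverts B \<subseteq> pverts G2"
proof (rule ccontr)
  assume "\<not> ?thesis"
  then obtain a b where a: "a \<in> pverts B" "a \<notin> pverts G2" and b: "b \<in> pverts B" "b \<notin> pverts G1"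
    by blast
  have conn: "connected_graph B" using B by (simp add: nonseparable_iff)
  have reach: "(a, b) \<in> (parcs B)\<^sup>*" using connected_graphD(7)[OF conn] a b by simp
  have a1: "a \<in> pverts G1" "a \<noteq> x" using a sub verts by auto
  have "arcs_avoiding (parcs B) x \<subseteq> arcs_avoiding (parcs G) x" using sub by (auto simp: arcs_avoiding_def)
  then have sep: "(a, b) \<notin> (arcs_avoiding (parcs B) x)\<^sup>*"
    using separated[of a b] rtrancl_mono a1 b sub(1) verts(1) by blast
  have "x \<in> pverts B"
  proof (rule ccontr)
    assume "x \<notin> pverts B"
    then have "arcs_avoiding (parcs B) x = parcs B"
      using connected_graphD(4)[OF conn] by (auto simp: arcs_avoiding_def)
    then show False using sep reach by simp
  qed
  moreover have "b \<noteq> x" using b x_in by auto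
  ultimately have "cutvertex B x"
    unfolding cutvertex_iff[OF connected_graphD(1)[OF conn]] using a b a1 reach sep by blast
  then show False using B by (simp add: nonseparable_iff)
qed

text \<open>
  A nonseparable subgraph \<open>B'\<close> of \<open>G\<close> above a block \<open>B\<close> of \<open>G1\<close> lies on one side.  In \<open>G1\<close> it equals \<open>B\<close>
  by maximality.  In \<open>G2\<close> it would force \<open>B\<close> to be the single vertex \<open>x\<close>, which is no block as soon as
  \<open>G1\<close> has an edge at \<open>x\<close>; this is why \<open>G1\<close> must have a second vertex.
\<close>

lemma block_part:
  assumes blk: "block G1 B" and big: "pverts G1 \<noteq> {x}"
  shows "block G B"
proof -
  note G = connected_graphD(1)[OF graph(1)]
  have B: "nonseparable B" "pverts B \<subseteq> pverts G1" "parcs B \<subseteq> parcs G1"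
    and max: "\<And>B'. nonseparable B' \<Longrightarrow> pverts B' \<subseteq> pverts G1 \<Longrightarrow> parcs B' \<subseteq> parcs G1 \<Longrightarrow>
      pverts B \<subseteq> pverts B' \<Longrightarrow> parcs B \<subseteq> parcs B' \<Longrightarrow> B' = B"
    using blk unfolding block_iff[OF graph(2)] by blast+
  have conn: "connected_graph B" using B by (simp add: nonseparable_iff)
  have "B' = B" if B': "nonseparable B'" "pverts B' \<subseteq> pverts G" "parcs B' \<subseteq> parcs G"
    "pverts B \<subseteq> pverts B'" "parcs B \<subseteq> parcs B'" for B'
  proof -
    have conn': "connected_graph B'" using B' by (simp add: nonseparable_iff)
    have in1: "pverts B' \<subseteq> pverts G1"
    proof (rule ccontr)
      assume "\<not> ?thesis"
      then have "pverts B' \<subseteq> pverts G2" using nonseparable_on_one_side B' by blast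
      then have "pverts B \<subseteq> {x}" using B(2) B'(4) verts(2) by auto
      then have B_x: "pverts B = {x}" using connected_graphD(2)[OF conn] by auto
      obtain z where "z \<in> pverts G1" "z \<noteq> x" using big x_in by blast
      then obtain y where y: "(x, y) \<in> parcs G1" "y \<in> pverts G1" "y \<noteq> x"
        using connected_graph_neighbour[OF connected_part x_in(1), of z] by metis
      let ?K = "\<lparr>pverts = {x, y}, parcs = {(x, y), (y, x)}\<rparr>"
      have "parcs B = {}" using connected_graphD(4,6)[OF conn] B_x by auto
      moreover have "(y, x) \<in> parcs G1"
        by (rule symD[OF connected_graphD(5)[OF connected_part] y(1)])
      ultimately have "?K = B"
        using nonseparable_edge[OF y(3)[symmetric]] y B_x x_in by (intro max) simp_all
      then have "y \<in> pverts B" by (metis insertI1 insert_commute pair_pre_digraph.select_convs(1))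
      then show False using B_x y(3) by simp
    qed
    have "parcs B' \<subseteq> parcs G1"
    proof
      fix e assume e: "e \<in> parcs B'"
      obtain a b where ab: "e = (a, b)" by (cases e)
      have "a \<in> pverts G1" "b \<in> pverts G1" "a \<noteq> b"
        using e ab connected_graphD(4,6)[OF conn'] in1 by blast+
      moreover have "c = x" if "c \<in> pverts G1" "c \<in> pverts G2" for c using verts(2) that by blast
      ultimately have "(a, b) \<notin> parcs G2" using arcs_in(2) by blast
      then show "e \<in> parcs G1" using e ab B'(3) arcs by blast
    qed
    then show ?thesis using max B' in1 by blast
  qed
  moreover have "pverts B \<subseteq> pverts G" "parcs B \<subseteq> parcs G" using B verts arcs by auto
  ultimately show ?thesis unfolding block_iff[OF G] using B(1) by blast
qed

end

text \<open>
  One side consists of \<open>x\<close> and a single component of what remains after the deletion of \<open>x\<close>, the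
  other one of everything outside this component.
\<close>

lemma cutvertex_split:
  assumes G: "connected_graph G" and x: "cutvertex G x"
  obtains G1 G2 where "one_point_union G G1 G2 x" "pverts G1 \<noteq> {x}" "pverts G2 \<noteq> {x}"
proof -
  obtain a b where x: "x \<in> pverts G" and a: "a \<in> pverts G" "a \<noteq> x" and b: "b \<in> pverts G" "b \<noteq> x"
    and sep: "(a, b) \<notin> (arcs_avoiding (parcs G) x)\<^sup>*"
    using x unfolding cutvertex_iff[OF connected_graphD(1)[OF G]] by blast
  note [simp] = connected_graphD(3)[OF G] connected_graphD(6)[OF G]
  note E = connected_graphD(4)[OF G]
  define C where "C = {c. (a, c) \<in> (arcs_avoiding (parcs G) x)\<^sup>*}"
  have C: "c \<in> pverts G \<and> c \<noteq> x" if "c \<in> C" for c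
    using that unfolding C_def mem_Collect_eq
    by induct (use a E in \<open>auto simp: arcs_avoiding_def\<close>)
  have closed: "d \<in> C" if "c \<in> C" "(c, d) \<in> parcs G" "d \<noteq> x" for c d
  proof -
    have "(c, d) \<in> arcs_avoiding (parcs G) x" using that C by (auto simp: arcs_avoiding_def)
    then show ?thesis using that(1) unfolding C_def by auto
  qed
  have sym: "(d, c) \<in> parcs G" if "(c, d) \<in> parcs G" for c d
    using connected_graphD(5)[OF G] that by (rule symD)
  define H where "H W = \<lparr>pverts = W, parcs = parcs G \<inter> W \<times> W\<rparr>" for W
  have H: "pair_graph (H W)" if "W \<subseteq> pverts G" for W
    using that finite_subset[OF that] sym by (auto simp: H_def pair_graph_iff sym_def)
  have W: "insert x C \<subseteq> pverts G" "pverts G - C \<subseteq> pverts G" using C x by auto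
  have "one_point_union G (H (insert x C)) (H (pverts G - C)) x"
  proof (rule one_point_union.intro)
    show "connected_graph G" by (rule G)
    show "pair_graph (H (insert x C))" "pair_graph (H (pverts G - C))" using H W by auto
    show "pverts G = pverts (H (insert x C)) \<union> pverts (H (pverts G - C))"
      "pverts (H (insert x C)) \<inter> pverts (H (pverts G - C)) = {x}"
      using C x by (auto simp: H_def)
    show "parcs G = parcs (H (insert x C)) \<union> parcs (H (pverts G - C))"
    proof
      show "parcs G \<subseteq> parcs (H (insert x C)) \<union> parcs (H (pverts G - C))"
      proof
        fix e assume "e \<in> parcs G"
        moreover obtain c d where "e = (c, d)" by (cases e)
        ultimately show "e \<in> parcs (H (insert x C)) \<union> parcs (H (pverts G - C))"
          using closed[of c d] closed[of d c] sym E by (auto simp: H_def)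
      qed
    qed (auto simp: H_def)
  qed
  moreover have "a \<in> C" "b \<notin> C" using sep by (auto simp: C_def)
  then have "pverts (H (insert x C)) \<noteq> {x}" "pverts (H (pverts G - C)) \<noteq> {x}"
    using a b by (auto simp: H_def)
  ultimately show ?thesis using that by blast
qed

section \<open>Skeletons and their gluing\<close>

text \<open>
  Auxiliary nodes carry a vertex set, namely that of the block they were made for.  Skeletons of graphs
  with one common vertex then meet in its stub only, without any renaming.
\<close>

datatype 'a node = Stub 'a | Aux "'a set" "'a set" nat

text \<open>
  If two vertices form a short pair and one of them is a cutvertex, then the block exposes that vertex.
\<close>

definition short_pair ::
  "'a pair_pre_digraph \<Rightarrow> ('a pair_pre_digraph \<Rightarrow> 'a set set) \<Rightarrow> 'a \<Rightarrow> 'a \<Rightarrow> bool" where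
  "short_pair G \<sigma> u v \<longleftrightarrow> (\<exists>B. block G B \<and> u \<in> pverts B \<and> v \<in> pverts B \<and>
     partite_class B u = partite_class B v \<and> partite_class B u \<in> \<sigma> B \<and>
     2 \<le> card (partite_class B u))"

text \<open>
  The two neighbours of each auxiliary node ensure that it is not a leaf.  The condition on sets of
  cardinality at least two makes the auxiliary nodes of two graphs with one common vertex distinct.
\<close>

definition skeleton ::
  "'a pair_pre_digraph \<Rightarrow> ('a pair_pre_digraph \<Rightarrow> 'a set set) \<Rightarrow> 'a node set \<Rightarrow> 'a node rel \<Rightarrow>
     ('a node \<Rightarrow> 'a node \<Rightarrow> nat) \<Rightarrow> bool" where
  "skeleton G \<sigma> N E d \<longleftrightarrow> tree_metric N E d \<and> Stub ` pverts G \<subseteq> N \<and>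
     N \<subseteq> Stub ` pverts G \<union> {Aux S A i | S A i. S \<subseteq> pverts G \<and> 2 \<le> card S} \<and>
     (\<forall>S A i. Aux S A i \<in> N \<longrightarrow> (\<exists>a b. a \<noteq> b \<and> (Aux S A i, a) \<in> E \<and> (Aux S A i, b) \<in> E)) \<and>
     (\<forall>u \<in> pverts G. \<forall>v \<in> pverts G. u \<noteq> v \<longrightarrow> 2 \<le> d (Stub u) (Stub v) \<and>
        ((u, v) \<in> parcs G \<longleftrightarrow> d (Stub u) (Stub v) = 4) \<and>
        (d (Stub u) (Stub v) = 2 \<longrightarrow> short_pair G \<sigma> u v))"

lemma skeletonD:
  assumes "skeleton G \<sigma> N E d"
  shows "tree_metric N E d"
    and "v \<in> pverts G \<Longrightarrow> Stub v \<in> N" and "Stub v \<in> N \<Longrightarrow> v \<in> pverts G"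
    and "Aux S A i \<in> N \<Longrightarrow> S \<subseteq> pverts G \<and> 2 \<le> card S"
    and "Aux S A i \<in> N \<Longrightarrow> \<exists>a b. a \<noteq> b \<and> (Aux S A i, a) \<in> E \<and> (Aux S A i, b) \<in> E"
    and "u \<in> pverts G \<Longrightarrow> v \<in> pverts G \<Longrightarrow> u \<noteq> v \<Longrightarrow> 2 \<le> d (Stub u) (Stub v)"
    and "u \<in> pverts G \<Longrightarrow> v \<in> pverts G \<Longrightarrow> u \<noteq> v \<Longrightarrow> (u, v) \<in> parcs G \<longleftrightarrow> d (Stub u) (Stub v) = 4"
    and "u \<in> pverts G \<Longrightarrow> v \<in> pverts G \<Longrightarrow> u \<noteq> v \<Longrightarrow> d (Stub u) (Stub v) = 2 \<Longrightarrow> short_pair G \<sigma> u v"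
  using assms unfolding skeleton_def by blast+

lemma (in one_point_union) short_pair_part:
  assumes "short_pair G1 \<sigma> u v" "pverts G1 \<noteq> {x}"
  shows "short_pair G \<sigma> u v"
  using assms block_part unfolding short_pair_def by blast

lemma (in one_point_union) orientation_part:
  assumes "exact_six_orientation G \<sigma>" "pverts G1 \<noteq> {x}"
  shows "exact_six_orientation G1 \<sigma>"
  using assms(1) block_part[OF _ assms(2)] unfolding exact_six_orientation_def by simp

lemma (in one_point_union) admissible_part:
  assumes "admissible G \<sigma>" "pverts G1 \<noteq> {x}"
  shows "admissible G1 \<sigma>"
  unfolding admissible_def
proof (intro allI impI)
  fix y assume y: "cutvertex G1 y"
  have "exposed G \<sigma> y B" if "exposed G1 \<sigma> y B" for B
    using that cutvertex_part block_part assms(2) by (auto simp: exposed_def)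
  then show "\<exists>\<^sub>\<le>\<^sub>1 B. exposed G1 \<sigma> y B"
    using assms(1) cutvertex_part[OF y] unfolding admissible_def Uniq_def by blast
qed

text \<open>
  This is where admissibility enters: the two short pairs would expose \<open>x\<close> in a block on either side.
\<close>

lemma (in one_point_union) not_short_on_both_sides:
  assumes adm: "admissible G \<sigma>" and big: "pverts G1 \<noteq> {x}" "pverts G2 \<noteq> {x}"
    and u: "u \<in> pverts G1" "u \<noteq> x"
    and short: "short_pair G1 \<sigma> u x" "short_pair G2 \<sigma> x v"
  shows False
proof -
  obtain B1 where B1: "block G1 B1" "u \<in> pverts B1" "x \<in> pverts B1" "partite_class B1 x \<in> \<sigma> B1"
    "2 \<le> card (partite_class B1 x)"
    using short(1) unfolding short_pair_def by metis
  obtain B2 where B2: "block G2 B2" "x \<in> pverts B2" "partite_class B2 x \<in> \<sigma> B2"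
    "2 \<le> card (partite_class B2 x)"
    using short(2) unfolding short_pair_def by metis
  interpret flip: one_point_union G G2 G1 x by (rule flip)
  obtain b where "b \<in> pverts G2 - {x}" using big(2) x_in by blast
  then have cut: "cutvertex G x" using cutvertex_x[of u b] u by blast
  have "exposed G \<sigma> x B1" "exposed G \<sigma> x B2"
    using cut block_part[OF B1(1) big(1)] flip.block_part[OF B2(1) big(2)] B1 B2
    by (auto simp: exposed_def)
  then have "B1 = B2" using adm cut by (auto simp: admissible_def dest: Uniq_D)
  then have "u \<in> pverts G2" using B1(2) B2(1) by (auto simp: block_iff graph)
  then show False using u verts(2) by blast
qed

text \<open>
  Distances between the two sides are sums of two distances that are at least 2, hence at least 4, and
  the sum \<open>2 + 2\<close> is excluded by admissibility.  So pairs from different sides are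
  at distance more than 4, as befits nonadjacent vertices.
\<close>

lemma (in one_point_union) skeleton_union:
  assumes S1: "skeleton G1 \<sigma> N1 E1 d1" and S2: "skeleton G2 \<sigma> N2 E2 d2"
    and big: "pverts G1 \<noteq> {x}" "pverts G2 \<noteq> {x}" and adm: "admissible G \<sigma>"
  shows "\<exists>d. skeleton G \<sigma> (N1 \<union> N2) (E1 \<union> E2) d"
proof -
  interpret flip: one_point_union G G2 G1 x by (rule flip)
  have only_x: "w = x" if "w \<in> pverts G1" "w \<in> pverts G2" for w using verts(2) that by blast
  have int: "N1 \<inter> N2 = {Stub x}"
  proof
    show "N1 \<inter> N2 \<subseteq> {Stub x}"
    proof
      fix z assume z: "z \<in> N1 \<inter> N2"
      show "z \<in> {Stub x}"
      proof (cases z)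
        case (Stub v)
        then show ?thesis using z skeletonD(3)[OF S1] skeletonD(3)[OF S2] only_x by auto
      next
        case (Aux S A i)
        then have "S \<subseteq> pverts G1" "S \<subseteq> pverts G2" "2 \<le> card S"
          using z skeletonD(4)[OF S1, of S A i] skeletonD(4)[OF S2, of S A i] by auto
        \<comment> \<open>An auxiliary node cannot be common: its set would lie in the one-point intersection.\<close>
        moreover from this have "S \<subseteq> {x}" using only_x by blast
        then have "card S \<le> 1" using card_mono[of "{x}" S] by simp
        ultimately show ?thesis by simp
      qed
    qed
    show "{Stub x} \<subseteq> N1 \<inter> N2" using x_in skeletonD(2)[OF S1] skeletonD(2)[OF S2] by simp
  qed
  obtain d where T: "tree_metric (N1 \<union> N2) (E1 \<union> E2) d"
    and d: "\<forall>u \<in> N1. \<forall>v \<in> N1. d u v = d1 u v" "\<forall>u \<in> N2. \<forall>v \<in> N2. d u v = d2 u v"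
      "\<forall>u \<in> N1. \<forall>v \<in> N2. d u v = d1 u (Stub x) + d2 (Stub x) v"
      "\<forall>u \<in> N2. \<forall>v \<in> N1. d u v = d2 u (Stub x) + d1 (Stub x) v"
    using tree_metric_union[OF skeletonD(1)[OF S1] skeletonD(1)[OF S2] int]
    by - (elim exE conjE, rule that)
  have in1: "v \<in> pverts G1 \<Longrightarrow> Stub v \<in> N1" and in2: "v \<in> pverts G2 \<Longrightarrow> Stub v \<in> N2" for v
    using skeletonD(2) S1 S2 by metis+
  let ?ok = "\<lambda>u v. 2 \<le> d (Stub u) (Stub v) \<and> ((u, v) \<in> parcs G \<longleftrightarrow> d (Stub u) (Stub v) = 4) \<and>
        (d (Stub u) (Stub v) = 2 \<longrightarrow> short_pair G \<sigma> u v)"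
  have ok1: "?ok u v" if "u \<in> pverts G1" "v \<in> pverts G1" "u \<noteq> v" for u v
  proof -
    have "(u, v) \<in> parcs G \<longleftrightarrow> (u, v) \<in> parcs G1"
      using that arcs arc_ends only_x by (metis Un_iff)
    then show ?thesis
      using skeletonD(6,7,8)[OF S1 that] short_pair_part[OF _ big(1)] d(1) in1 that by simp
  qed
  have ok2: "?ok u v" if "u \<in> pverts G2" "v \<in> pverts G2" "u \<noteq> v" for u v
  proof -
    have "(u, v) \<in> parcs G \<longleftrightarrow> (u, v) \<in> parcs G2"
      using that arcs arc_ends only_x by (metis Un_iff)
    then show ?thesis
      using skeletonD(6,7,8)[OF S2 that] flip.short_pair_part[OF _ big(2)] d(2) in2 that by simp
  qed
  have no_arc: "(u, v) \<notin> parcs G" "(v, u) \<notin> parcs G"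
    if "u \<in> pverts G1 - {x}" "v \<in> pverts G2 - {x}" for u v
    using that arcs arc_ends only_x by (metis Diff_iff Un_iff insertI1)+
  have ok12: "?ok u v" if u: "u \<in> pverts G1" "u \<noteq> x" and v: "v \<in> pverts G2" "v \<noteq> x" for u v
  proof -
    have "d (Stub u) (Stub v) = d1 (Stub u) (Stub x) + d2 (Stub x) (Stub v)"
      using u v in1 in2 d(3) by simp
    moreover have "2 \<le> d1 (Stub u) (Stub x)" "2 \<le> d2 (Stub x) (Stub v)"
      using skeletonD(6)[OF S1, of u x] skeletonD(6)[OF S2, of x v] u v x_in by auto
    moreover have "\<not> (d1 (Stub u) (Stub x) = 2 \<and> d2 (Stub x) (Stub v) = 2)"
      using skeletonD(8)[OF S1, of u x] skeletonD(8)[OF S2, of x v] u v x_in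
        not_short_on_both_sides[OF adm big u] by auto
    ultimately show ?thesis using no_arc[of u v] u v by auto
  qed
  have ok21: "?ok u v" if u: "u \<in> pverts G2" "u \<noteq> x" and v: "v \<in> pverts G1" "v \<noteq> x" for u v
  proof -
    have "d (Stub u) (Stub v) = d2 (Stub u) (Stub x) + d1 (Stub x) (Stub v)"
      using u v in1 in2 d(4) by simp
    moreover have "2 \<le> d2 (Stub u) (Stub x)" "2 \<le> d1 (Stub x) (Stub v)"
      using skeletonD(6)[OF S2, of u x] skeletonD(6)[OF S1, of x v] u v x_in by auto
    moreover have "\<not> (d2 (Stub u) (Stub x) = 2 \<and> d1 (Stub x) (Stub v) = 2)"
      using skeletonD(8)[OF S2, of u x] skeletonD(8)[OF S1, of x v] u v x_in
        flip.not_short_on_both_sides[OF adm big(2,1) u] by auto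
    ultimately show ?thesis using no_arc[of v u] u v by auto
  qed
  have "?ok u v" if "u \<in> pverts G" "v \<in> pverts G" "u \<noteq> v" for u v
    using that ok1[of u v] ok2[of u v] ok12[of u v] ok21[of u v] verts(1) x_in by blast
  moreover have "Stub ` pverts G \<subseteq> N1 \<union> N2" using in1 in2 verts(1) by auto
  moreover have "N1 \<union> N2 \<subseteq> Stub ` pverts G \<union> {Aux S A i | S A i. S \<subseteq> pverts G \<and> 2 \<le> card S}"
  proof
    fix z assume z: "z \<in> N1 \<union> N2"
    show "z \<in> Stub ` pverts G \<union> {Aux S A i | S A i. S \<subseteq> pverts G \<and> 2 \<le> card S}"
    proof (cases z)
      case (Stub v)
      then show ?thesis using z skeletonD(3)[OF S1] skeletonD(3)[OF S2] verts(1) by auto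
    next
      case (Aux S A i)
      then have "S \<subseteq> pverts G" "2 \<le> card S"
        using z skeletonD(4)[OF S1, of S A i] skeletonD(4)[OF S2, of S A i] verts(1) by auto
      then show ?thesis using Aux by blast
    qed
  qed
  moreover have "\<exists>a b. a \<noteq> b \<and> (Aux S A i, a) \<in> E1 \<union> E2 \<and> (Aux S A i, b) \<in> E1 \<union> E2"
    if "Aux S A i \<in> N1 \<union> N2" for S A i
    using that skeletonD(5)[OF S1, of S A i] skeletonD(5)[OF S2, of S A i] by blast
  ultimately have "skeleton G \<sigma> (N1 \<union> N2) (E1 \<union> E2) d"
    unfolding skeleton_def using T by blast
  then show ?thesis by blast
qed

section \<open>Skeletons of blocks and of graphs\<close>

lemma complete_multipartition_facts:
  assumes "complete_multipartition G \<P>" "v \<in> pverts G"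
  shows "partite_class G v \<in> \<P>" "v \<in> partite_class G v" "partite_class G v \<subseteq> pverts G"
    and "u \<in> pverts G \<Longrightarrow> (v, u) \<in> parcs G \<longleftrightarrow> partite_class G v \<noteq> partite_class G u"
proof -
  have part: "\<Union>\<P> = pverts G"
    and arcs: "\<And>u v. u \<in> pverts G \<Longrightarrow> v \<in> pverts G \<Longrightarrow>
      (u, v) \<in> parcs G \<longleftrightarrow> \<not> (\<exists>P \<in> \<P>. u \<in> P \<and> v \<in> P)"
    using assms(1) by (auto simp: complete_multipartition_def partition_on_def)
  have cls: "partite_class G w \<in> \<P> \<and> w \<in> partite_class G w" if w: "w \<in> pverts G" for w
  proof -
    obtain P where "P \<in> \<P>" "w \<in> P" using part w by blast
    then show ?thesis using partite_class_eqI[OF assms(1)] by metis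
  qed
  then show "partite_class G v \<in> \<P>" "v \<in> partite_class G v" using assms(2) by auto
  then show "partite_class G v \<subseteq> pverts G" using part by blast
  show "(v, u) \<in> parcs G \<longleftrightarrow> partite_class G v \<noteq> partite_class G u" if u: "u \<in> pverts G"
    using arcs[OF assms(2) u] cls[OF u] cls[OF assms(2)] partite_class_eqI[OF assms(1)] by metis
qed

lemma short_pair_selfI:
  assumes "block G G" "complete_multipartition G \<P>" "finite (pverts G)"
    and "u \<in> pverts G" "v \<in> pverts G" "u \<noteq> v"
    and "partite_class G u = partite_class G v" "partite_class G u \<in> \<sigma> G"
  shows "short_pair G \<sigma> u v"
proof -
  have "{u, v} \<subseteq> partite_class G u"
    using complete_multipartition_facts(2)[OF assms(2)] assms(4,5,7) by auto
  moreover have "finite (partite_class G u)"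
    using complete_multipartition_facts(3)[OF assms(2,4)] assms(3) finite_subset by blast
  ultimately have "2 \<le> card (partite_class G u)"
    using card_mono[of "partite_class G u" "{u, v}"] assms(6) by simp
  then show ?thesis using assms unfolding short_pair_def by blast
qed

primrec stub_of :: "'a node \<Rightarrow> 'a" where "stub_of (Stub v) = v"

text \<open>
  The map along which the layers of auxiliary nodes are attached.  \<open>Aux V {} 0\<close> is the hub of a
  block with vertex set \<open>V\<close>, and \<open>Aux V A i\<close> is the \<open>i\<close>-th node on the path from the hub towards \<open>A\<close>.
\<close>

primrec toward_hub :: "'a node \<Rightarrow> 'a node" where
  "toward_hub (Aux S A i) = (if i = 1 then Aux S {} 0 else Aux S A (i - 1))"

text \<open>
  The hub, one node per class at distance 1, the stubs at distance 2.  Every class of at least two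
  vertices is short here, so distance 2 occurs for short pairs only.
\<close>

lemma skeleton_multipartite:
  assumes G: "connected_graph G" and blk: "block G G" and cm: "complete_multipartition G \<P>"
    and two: "A \<in> \<P>" "B \<in> \<P>" "A \<noteq> B"
    and short: "\<And>P. P \<in> \<P> \<Longrightarrow> \<not> is_singleton P \<Longrightarrow> P \<in> \<sigma> G"
  shows "\<exists>N E d. skeleton G \<sigma> N E d"
proof -
  let ?V = "pverts G"
  let ?c = "partite_class G"
  let ?H = "Aux ?V {} 0"
  define S1 where "S1 = (\<lambda>P. Aux ?V P 1) ` \<P>"
  define q where "q z = Aux ?V (?c (stub_of z)) 1" for z
  have q [simp]: "q (Stub v) = Aux ?V (?c v) 1" for v by (simp add: q_def)
  note fin = connected_graphD(3)[OF G]
  note cls = complete_multipartition_facts[OF cm]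
  have ne: "P \<noteq> {}" "P \<subseteq> ?V" if "P \<in> \<P>" for P
    using cm that by (auto simp: complete_multipartition_def partition_on_def)
  have "finite \<P>"
    using cm fin by (auto simp: complete_multipartition_def intro: finite_elements)
  then have S1: "finite S1" by (simp add: S1_def)
  obtain a b where ab: "a \<in> A" "b \<in> B" using ne two by blast
  then have c_ab: "?c a = A" "?c b = B" using partite_class_eqI[OF cm] two by auto
  have ab_V: "a \<in> ?V" "b \<in> ?V" "a \<noteq> b" using ab ne two c_ab by auto
  then have card: "2 \<le> card ?V" using card_mono[OF fin, of "{a, b}"] by simp
  have disj1: "S1 \<inter> {?H} = {}" and to_H: "toward_hub ` S1 \<subseteq> {?H}"
    by (auto simp: S1_def)
  \<comment> \<open>The tree grows in layers: the hub, then the nodes of the classes, then the stubs.\<close>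
  obtain d1 where T1: "tree_metric ({?H} \<union> S1) ({} \<union> pendants S1 toward_hub) d1"
    and d1: "\<forall>s \<in> S1. \<forall>t \<in> S1. s \<noteq> t \<longrightarrow> d1 s t = 0 + 2"
    using tree_metric_pendants[OF tree_metric_singleton[of ?H] S1 disj1 to_H]
    by - (elim exE conjE, rule that)
  have d1_0: "d1 s s = 0" if "s \<in> S1" for s using tree_metricD(5)[OF T1] that by simp
  have q_in: "q ` Stub ` ?V \<subseteq> {?H} \<union> S1" using cls by (auto simp: S1_def)
  have stubs: "finite (Stub ` ?V)" "Stub ` ?V \<inter> ({?H} \<union> S1) = {}"
    using fin by (auto simp: S1_def)
  obtain d where T: "tree_metric (({?H} \<union> S1) \<union> Stub ` ?V)
      (({} \<union> pendants S1 toward_hub) \<union> pendants (Stub ` ?V) q) d"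
    and d: "\<forall>s \<in> Stub ` ?V. \<forall>t \<in> Stub ` ?V. s \<noteq> t \<longrightarrow> d s t = d1 (q s) (q t) + 2"
    using tree_metric_pendants[OF T1 stubs q_in]
    by - (elim exE conjE, rule that)
  have dist: "d (Stub u) (Stub v) = (if ?c u = ?c v then 2 else 4)"
    if "u \<in> ?V" "v \<in> ?V" "u \<noteq> v" for u v
  proof -
    have "Aux ?V (?c u) 1 \<in> S1" "Aux ?V (?c v) 1 \<in> S1" using cls that by (auto simp: S1_def)
    then show ?thesis using d[rule_format, of "Stub u" "Stub v"] that d1 d1_0 by auto
  qed
  have "short_pair G \<sigma> u v" if "u \<in> ?V" "v \<in> ?V" "u \<noteq> v" "?c u = ?c v" for u v
  proof -
    have "u \<in> ?c u" "v \<in> ?c u" using cls that by auto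
    then have "\<not> is_singleton (?c u)" using that(3) by (auto simp: is_singleton_def)
    then show ?thesis using short_pair_selfI[OF blk cm fin that] short cls(1) that(1) by blast
  qed
  moreover have "\<exists>a b. a \<noteq> b \<and> (Aux S P i, a) \<in> pendants S1 toward_hub \<union> pendants (Stub ` ?V) q \<and>
     (Aux S P i, b) \<in> pendants S1 toward_hub \<union> pendants (Stub ` ?V) q"
    if "Aux S P i \<in> {?H} \<union> S1" for S P i
  proof (cases "i = 0")
    case True
    then have "Aux S P i = ?H" using that by (auto simp: S1_def)
    then show ?thesis using two
      by (intro exI[of _ "Aux ?V A 1"] exI[of _ "Aux ?V B 1"]) (auto simp: pendants_iff S1_def)
  next
    case False
    then have i: "S = ?V" "i = 1" "P \<in> \<P>" using that by (auto simp: S1_def)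
    obtain v where "v \<in> P" using ne(1) i(3) by blast
    then have "v \<in> ?V" "?c v = P" using ne(2) i(3) partite_class_eqI[OF cm] by auto
    then show ?thesis using i
      by (intro exI[of _ "?H"] exI[of _ "Stub v"]) (auto simp: pendants_iff S1_def)
  qed
  ultimately have "skeleton G \<sigma> (({?H} \<union> S1) \<union> Stub ` ?V)
      (({} \<union> pendants S1 toward_hub) \<union> pendants (Stub ` ?V) q) d"
    unfolding skeleton_def using T card dist cls(4) by (auto simp: S1_def)
  then show ?thesis by blast
qed

text \<open>
  The stubs of the short class \<open>P\<close> are adjacent to the hub, those of \<open>Q\<close> end disjoint paths of length
  3 from it.
\<close>

lemma skeleton_bipartite:
  assumes G: "connected_graph G" and blk: "block G G" and cm: "complete_multipartition G {P, Q}"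
    and PQ: "P \<noteq> Q" and short: "P \<in> \<sigma> G"
  shows "\<exists>N E d. skeleton G \<sigma> N E d"
proof -
  let ?V = "pverts G"
  let ?c = "partite_class G"
  let ?H = "Aux ?V {} 0"
  define S1 where "S1 = (\<lambda>v. Aux ?V {v} 1) ` Q"
  define S2 where "S2 = (\<lambda>v. Aux ?V {v} 2) ` Q"
  define q where "q z = (if stub_of z \<in> P then ?H else Aux ?V {stub_of z} 2)" for z
  have q [simp]: "q (Stub v) = (if v \<in> P then ?H else Aux ?V {v} 2)" for v by (simp add: q_def)
  note fin = connected_graphD(3)[OF G]
  note cls = complete_multipartition_facts[OF cm]
  have V: "?V = P \<union> Q" "P \<noteq> {}" "Q \<noteq> {}" "P \<inter> Q = {}"
    using cm PQ by (auto simp: complete_multipartition_def partition_on_def disjoint_def)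
  have other: "v \<in> Q" if "v \<in> ?V" "v \<notin> P" for v using V(1) that by blast
  obtain a b where ab: "a \<in> P" "b \<in> Q" using V by blast
  have c_P: "?c v = P" if "v \<in> P" for v using partite_class_eqI[OF cm] that by simp
  have c_Q: "?c v = Q" if "v \<in> Q" for v using partite_class_eqI[OF cm] that by simp
  have "a \<noteq> b" using ab V by blast
  then have card: "2 \<le> card ?V" using card_mono[OF fin, of "{a, b}"] ab V by simp
  have S: "finite S1" "finite S2" "finite (Stub ` ?V)" using fin V by (auto simp: S1_def S2_def)
  have disj: "S1 \<inter> {?H} = {}" "S2 \<inter> ({?H} \<union> S1) = {}" "Stub ` ?V \<inter> (({?H} \<union> S1) \<union> S2) = {}"
    by (auto simp: S1_def S2_def)
  have to_H: "toward_hub ` S1 \<subseteq> {?H}" by (auto simp: S1_def)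
  \<comment> \<open>The layers: the hub, the two inner nodes of each path to Q, and finally all stubs, those of P
    on the hub and those of Q at the ends of the paths.\<close>
  obtain d1 where T1: "tree_metric ({?H} \<union> S1) ({} \<union> pendants S1 toward_hub) d1"
    and d1: "\<forall>s \<in> S1. \<forall>v \<in> {?H}. d1 s v = 0 + 1"
     "\<forall>u \<in> {?H}. \<forall>s \<in> S1. d1 u s = 0 + 1"
     "\<forall>s \<in> S1. \<forall>t \<in> S1. s \<noteq> t \<longrightarrow> d1 s t = 0 + 2"
    using tree_metric_pendants[OF tree_metric_singleton[of ?H] S(1) disj(1) to_H]
    by - (elim exE conjE, rule that)
  have in1: "toward_hub ` S2 \<subseteq> {?H} \<union> S1" by (auto simp: S1_def S2_def)
  obtain d2 where T2: "tree_metric (({?H} \<union> S1) \<union> S2)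
      (({} \<union> pendants S1 toward_hub) \<union> pendants S2 toward_hub) d2"
    and d2: "\<forall>s \<in> S2. \<forall>v \<in> {?H} \<union> S1. d2 s v = d1 (toward_hub s) v + 1"
     "\<forall>u \<in> {?H} \<union> S1. \<forall>s \<in> S2. d2 u s = d1 u (toward_hub s) + 1"
     "\<forall>s \<in> S2. \<forall>t \<in> S2. s \<noteq> t \<longrightarrow> d2 s t = d1 (toward_hub s) (toward_hub t) + 2"
    using tree_metric_pendants[OF T1 S(2) disj(2) in1]
    by - (elim exE conjE, rule that)
  have in2: "q ` Stub ` ?V \<subseteq> ({?H} \<union> S1) \<union> S2"
    using other by (auto simp: S2_def)
  obtain d where T: "tree_metric ((({?H} \<union> S1) \<union> S2) \<union> Stub ` ?V)
      ((({} \<union> pendants S1 toward_hub) \<union> pendants S2 toward_hub) \<union> pendants (Stub ` ?V) q) d"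
    and d: "\<forall>s \<in> Stub ` ?V. \<forall>t \<in> Stub ` ?V. s \<noteq> t \<longrightarrow> d s t = d2 (q s) (q t) + 2"
    using tree_metric_pendants[OF T2 S(3) disj(3) in2]
    by - (elim exE conjE, rule that)
  have H0: "d2 ?H ?H = 0" using tree_metricD(5)[OF T2] by simp
  have HQ: "d2 ?H (Aux ?V {v} 2) = 2" "d2 (Aux ?V {v} 2) ?H = 2" if "v \<in> Q" for v
    using that d2(1)[rule_format, of "Aux ?V {v} 2" ?H] d2(2)[rule_format, of ?H "Aux ?V {v} 2"]
      d1(1)[rule_format, of "Aux ?V {v} 1" ?H] d1(2)[rule_format, of ?H "Aux ?V {v} 1"]
    by (auto simp: S1_def S2_def)
  have QQ: "d2 (Aux ?V {u} 2) (Aux ?V {v} 2) = 4" if "u \<in> Q" "v \<in> Q" "u \<noteq> v" for u v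
    using that d2(3)[rule_format, of "Aux ?V {u} 2" "Aux ?V {v} 2"]
      d1(3)[rule_format, of "Aux ?V {u} 1" "Aux ?V {v} 1"]
    by (auto simp: S1_def S2_def)
  have dist: "d (Stub u) (Stub v) =
      (if u \<in> P \<and> v \<in> P then 2 else if u \<in> Q \<and> v \<in> Q then 6 else 4)"
    if "u \<in> ?V" "v \<in> ?V" "u \<noteq> v" for u v
    using d[rule_format, of "Stub u" "Stub v"] that V H0 HQ QQ by auto
  have arc: "(u, v) \<in> parcs G \<longleftrightarrow> \<not> (u \<in> P \<and> v \<in> P) \<and> \<not> (u \<in> Q \<and> v \<in> Q)"
    if "u \<in> ?V" "v \<in> ?V" for u v
  proof -
    have "?c w = (if w \<in> P then P else Q)" if "w \<in> ?V" for w using that c_P c_Q other by simp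
    moreover have "w \<in> Q \<longleftrightarrow> w \<notin> P" if "w \<in> ?V" for w using that V by blast
    ultimately show ?thesis using cls(4)[OF that] that PQ by simp
  qed
  have shortP: "short_pair G \<sigma> u v" if "u \<in> P" "v \<in> P" "u \<noteq> v" for u v
    using short_pair_selfI[OF blk cm fin, of u v \<sigma>] that c_P V(1) short by simp
  let ?E = "(({} \<union> pendants S1 toward_hub) \<union> pendants S2 toward_hub) \<union> pendants (Stub ` ?V) q"
  have deg: "\<exists>a b. a \<noteq> b \<and> (Aux S A i, a) \<in> ?E \<and> (Aux S A i, b) \<in> ?E"
    if "Aux S A i \<in> ({?H} \<union> S1) \<union> S2" for S A i
  proof -
    from that consider "Aux S A i = ?H" | v where "v \<in> Q" "Aux S A i = Aux ?V {v} 1"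
      | v where "v \<in> Q" "Aux S A i = Aux ?V {v} 2"
      by (auto simp: S1_def S2_def)
    then show ?thesis
    proof cases
      case 1
      then show ?thesis using ab V(1)
        by (intro exI[of _ "Stub a"] exI[of _ "Aux ?V {b} 1"]) (auto simp: pendants_iff S1_def)
    next
      case (2 v)
      then show ?thesis
        by (intro exI[of _ ?H] exI[of _ "Aux ?V {v} 2"]) (auto simp: pendants_iff S1_def S2_def)
    next
      case (3 v)
      then have "v \<notin> P" using V by blast
      then show ?thesis using 3 V(1)
        by (intro exI[of _ "Stub v"] exI[of _ "Aux ?V {v} 1"]) (auto simp: pendants_iff S2_def)
    qed
  qed
  have "skeleton G \<sigma> ((({?H} \<union> S1) \<union> S2) \<union> Stub ` ?V) ?E d"
    unfolding skeleton_def
  proof (intro conjI ballI impI allI)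
    show "({?H} \<union> S1 \<union> S2) \<union> Stub ` ?V
      \<subseteq> Stub ` ?V \<union> {Aux S A i | S A i. S \<subseteq> ?V \<and> 2 \<le> card S}"
      using card by (auto simp: S1_def S2_def)
  qed (use T dist arc shortP deg V in \<open>auto split: if_splits\<close>)
  then show ?thesis by blast
qed

text \<open>
  Induction along cutvertices.  Both orientation and admissibility pass to the parts because their
  blocks and cutvertices are blocks and cutvertices of the whole graph.  A single vertex has to be left
  out: its skeleton would consist of one stub, which becomes a leaf once its vertex is attached.
\<close>

lemma skeleton_exists:
  assumes "connected_graph G" "2 \<le> card (pverts G)" "\<And>B. block G B \<Longrightarrow> complete_multipartite B"
    and "exact_six_orientation G \<sigma>" "admissible G \<sigma>"
  shows "\<exists>N E d. skeleton G \<sigma> N E d"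
  using assms
proof (induct "card (pverts G)" arbitrary: G rule: less_induct)
  case less
  note G = less(2) and big = less(3) and cm = less(4) and or = less(5) and adm = less(6)
  show ?case
  proof (cases "\<exists>x. cutvertex G x")
    case True
    then obtain x G1 G2 where "one_point_union G G1 G2 x"
      and big12: "pverts G1 \<noteq> {x}" "pverts G2 \<noteq> {x}"
      using cutvertex_split[OF G] by metis
    then interpret one_point_union G G1 G2 x by simp
    interpret flip: one_point_union G G2 G1 x by (rule flip)
    have fin: "finite (pverts G1)" "finite (pverts G2)" "finite (pverts G)"
      using connected_part flip.connected_part G connected_graphD(3) by blast+
    \<comment> \<open>Both parts have a vertex besides x, so they are proper and not single vertices.\<close>
    have card2: "2 \<le> card W" if W: "W \<noteq> {x}" "x \<in> W" "finite W" for W :: "'a set"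
    proof -
      obtain y where "y \<in> W" "y \<noteq> x" using W by blast
      then show ?thesis using card_mono[OF W(3), of "{x, y}"] W(2) by simp
    qed
    have "pverts G1 \<subset> pverts G" "pverts G2 \<subset> pverts G"
      using verts big12 x_in by blast+
    then have smaller: "card (pverts G1) < card (pverts G)" "card (pverts G2) < card (pverts G)"
      using fin(3) psubset_card_mono by blast+
    have "\<exists>N E d. skeleton G1 \<sigma> N E d"
      using less(1)[OF smaller(1) connected_part] card2[OF big12(1) x_in(1) fin(1)]
        cm block_part[OF _ big12(1)] orientation_part[OF or big12(1)]
          admissible_part[OF adm big12(1)] by simp
    moreover have "\<exists>N E d. skeleton G2 \<sigma> N E d"
      using less(1)[OF smaller(2) flip.connected_part] card2[OF big12(2) x_in(2) fin(2)]
        cm flip.block_part[OF _ big12(2)] flip.orientation_part[OF or big12(2)]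
          flip.admissible_part[OF adm big12(2)] by simp
    ultimately show ?thesis using skeleton_union big12 adm by blast
  next
    case False
    then have blk: "block G G" using block_self[OF G] by blast
    then obtain \<P> where P: "complete_multipartition G \<P>"
      using cm unfolding complete_multipartite_def by blast
    note cls = complete_multipartition_facts[OF P]
    have fin: "finite \<P>"
      using P connected_graphD(3)[OF G]
      by (auto simp: complete_multipartition_def intro: finite_elements)
    obtain a b where ab: "a \<in> pverts G" "b \<in> pverts G" "a \<noteq> b"
      using big by (meson card_2_iff' obtain_subset_with_card_n subsetD)
    \<comment> \<open>An edge gives two classes.\<close>
    obtain c where "(a, c) \<in> parcs G" "c \<in> pverts G"
      using connected_graph_neighbour[OF G ab] by metis
    then have "partite_class G a \<noteq> partite_class G c" using cls(4) ab(1) by blast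
    moreover have in_P: "partite_class G a \<in> \<P>" "partite_class G c \<in> \<P>"
      using cls(1) ab(1) \<open>c \<in> pverts G\<close> by auto
    ultimately have "2 \<le> card \<P>"
      using card_mono[OF fin, of "{partite_class G a, partite_class G c}"] by simp
    then consider "card \<P> = 2" | "3 \<le> card \<P>" by linarith
    then show ?thesis
    proof cases
      case 1
      then obtain A where A: "A \<in> \<P>" "\<sigma> G = {A}"
        using or blk partite_classes_eqI[OF P] unfolding exact_six_orientation_def by metis
      obtain R S where "\<P> = {R, S}" "R \<noteq> S" using 1 by (auto simp: card_2_iff)
      then consider "\<P> = {A, S}" "A \<noteq> S" | "\<P> = {A, R}" "A \<noteq> R" using A(1) by auto
      then show ?thesis using skeleton_bipartite[OF G blk] P A(2) by cases auto
    next
      case 2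
      then have "\<sigma> G = {P \<in> \<P>. \<not> is_singleton P}"
        using or blk partite_classes_eqI[OF P] unfolding exact_six_orientation_def by metis
      then show ?thesis
        using skeleton_multipartite[OF G blk P in_P] \<open>partite_class G a \<noteq> partite_class G c\<close> by simp
    qed
  qed
qed

section \<open>Hanging the leaves\<close>

lemma not_leafI:
  assumes "(z, a) \<in> parcs T" "(z, b) \<in> parcs T" "a \<noteq> b" "pverts T \<noteq> {z}"
  shows "z \<notin> leaves T"
proof
  assume "z \<in> leaves T"
  then obtain e where "out_arcs (with_proj T) z = {e}"
    using assms(4) by (auto simp: leaves_def out_degree_def card_1_singleton_iff)
  moreover have "(z, a) \<in> out_arcs (with_proj T) z" "(z, b) \<in> out_arcs (with_proj T) z"
    using assms by (simp_all add: out_arcs_def)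
  ultimately show False using assms(3) by (metis prod.inject singletonD)
qed

text \<open>
  Attaching a leaf to each stub adds 2 to the distances, which turns 4 into 6.  The new nodes are the
  only leaves: a stub has its leaf and, as there is another stub, a neighbour in the skeleton; the
  auxiliary nodes have two neighbours already.
\<close>

lemma exact_leaf_power_of_skeleton:
  assumes sk: "skeleton G \<sigma> N E d" and V: "finite (pverts G)" "a \<in> pverts G" "b \<in> pverts G" "a \<noteq> b"
  shows "exact_leaf_power 6 G"
proof -
  note T0 = skeletonD(1)[OF sk]
  \<comment> \<open>The skeleton is copied into the right summand of the vertex type, the left one being reserved
    for the leaves.\<close>
  obtain f :: "'a node \<Rightarrow> nat" where f: "inj_on f N"
    using finite_imp_inj_to_nat_seg[OF tree_metricD(1)[OF T0]] by blast
  define g :: "'a node \<Rightarrow> 'a + nat" where "g = Inr \<circ> f"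
  have g: "inj_on g N" using f by (auto simp: g_def inj_on_def)
  let ?E1 = "map_prod g g ` E"
  obtain d1 where T1: "tree_metric (g ` N) ?E1 d1"
    and d1: "\<forall>u \<in> N. \<forall>v \<in> N. d1 (g u) (g v) = d u v"
    using tree_metric_image[OF T0 g] by - (elim exE conjE, rule that)
  define S :: "('a + nat) set" where "S = Inl ` pverts G"
  define q where "q z = g (Stub (projl z))" for z :: "'a + nat"
  have S: "finite S" "S \<inter> g ` N = {}" using V by (auto simp: S_def g_def)
  have qS: "q ` S \<subseteq> g ` N" using skeletonD(2)[OF sk] by (auto simp: S_def q_def)
  obtain d2 where T2: "tree_metric (g ` N \<union> S) (?E1 \<union> pendants S q) d2"
    and d2: "\<forall>s \<in> S. \<forall>t \<in> S. s \<noteq> t \<longrightarrow> d2 s t = d1 (q s) (q t) + 2"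
    using tree_metric_pendants[OF T1 S qS] by - (elim exE conjE, rule that)
  define T where "T = \<lparr>pverts = g ` N \<union> S, parcs = ?E1 \<union> pendants S q\<rparr>"
  have T: "tree_metric (pverts T) (parcs T) d2" using T2 by (simp add: T_def)
  have SV: "Inl v \<in> pverts T" if "v \<in> pverts G" for v using that by (simp add: T_def S_def)
  have tree: "undirected_tree T" using undirected_treeI[OF T] SV V by blast
  have EN: "u \<in> N" "v \<in> N" if "(u, v) \<in> E" for u v using tree_metricD(2)[OF T0] that by auto
  have "graph_dist T (Inl u) (Inl v) = ereal (real 6) \<longleftrightarrow> (u, v) \<in> parcs G"
    if uv: "u \<in> pverts G" "v \<in> pverts G" "u \<noteq> v" for u v
  proof -
    have "d2 (Inl u) (Inl v) = d (Stub u) (Stub v) + 2"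
      using uv d1 d2 skeletonD(2)[OF sk] by (simp add: S_def q_def)
    then have "graph_dist T (Inl u) (Inl v) = ereal (real (d (Stub u) (Stub v) + 2))"
      using graph_dist_eq[OF T SV[OF uv(1)] SV[OF uv(2)]] by simp
    then show ?thesis using skeletonD(7)[OF sk uv] by auto
  qed
  moreover have "leaves T = Inl ` pverts G"
  proof
    show "Inl ` pverts G \<subseteq> leaves T"
    proof
      fix z :: "'a + nat" assume "z \<in> Inl ` pverts G"
      then obtain v where v: "v \<in> pverts G" "z = Inl v" by blast
      have "out_arcs (with_proj T) (Inl v) = {(Inl v, g (Stub v))}"
        using v by (auto simp: out_arcs_def T_def pendants_def S_def q_def g_def)
      then show "z \<in> leaves T" using v SV by (simp add: leaves_def out_degree_def)
    qed
    show "leaves T \<subseteq> Inl ` pverts G"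
    proof
      fix z assume leaf: "z \<in> leaves T"
      have more: "pverts T \<noteq> {z}" if "z = g w" for w
        using SV[OF V(2)] that by (auto simp: g_def)
      have inner: "z \<notin> leaves T" if w: "z = g w" "w \<in> N" for w
      proof (cases w)
        case (Stub v)
        then have v: "v \<in> pverts G" using skeletonD(3)[OF sk] w(2) by simp
        then obtain u where "u \<in> pverts G" "u \<noteq> v" using V by metis
        then obtain y where "(Stub v, y) \<in> E"
          using level_functionD(3)[OF tree_metricD(4)[OF T0, of "Stub u"], of "Stub v"]
            skeletonD(2)[OF sk] v by blast
        then have "(z, g y) \<in> parcs T" using w(1) Stub by (auto simp: T_def)
        moreover have "(z, Inl v) \<in> parcs T"
          using w(1) Stub v by (simp add: T_def pendants_iff S_def q_def)
        ultimately show ?thesis by (rule not_leafI) (use more[OF w(1)] in \<open>simp_all add: g_def\<close>)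
      next
        case (Aux R A i)
        then obtain x y where xy: "x \<noteq> y" "(w, x) \<in> E" "(w, y) \<in> E"
          using skeletonD(5)[OF sk] w(2) by blast
        then have "(z, g x) \<in> parcs T" "(z, g y) \<in> parcs T" using w(1) by (auto simp: T_def)
        moreover have "g x \<noteq> g y" using xy EN inj_onD[OF g] by blast
        ultimately show ?thesis using more[OF w(1)] by (rule not_leafI)
      qed
      moreover have "z \<in> g ` N \<union> S" using leaf by (simp add: leaves_def T_def)
      ultimately show "z \<in> Inl ` pverts G" using leaf by (auto simp: S_def)
    qed
  qed
  ultimately show ?thesis using tree unfolding exact_leaf_power_def by blast
qed

lemma exact_leaf_power_singleton:
  assumes "pverts G = {v}"
  shows "exact_leaf_power k G"
proof -
  let ?T = "\<lparr>pverts = {Inl v :: 'a + nat}, parcs = {}\<rparr>"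
  have "undirected_tree ?T" using undirected_treeI[of ?T "\<lambda>_ _. 0"] by (simp add: tree_metric_singleton)
  moreover have "leaves ?T = Inl ` pverts G" using assms by (auto simp: leaves_def)
  ultimately show ?thesis using assms unfolding exact_leaf_power_def
    by (intro exI[of _ ?T]) simp
qed

theorem theorem6p8:
  fixes G :: "'a pair_pre_digraph"
  assumes "block_complete_multipartite G"
    and "\<exists>\<sigma>. exact_six_orientation G \<sigma> \<and> admissible G \<sigma>"
  shows "exact_leaf_power 6 G"
proof -
  obtain \<sigma> where \<sigma>: "exact_six_orientation G \<sigma>" "admissible G \<sigma>" using assms(2) by blast
  have G: "connected_graph G" and cm: "\<And>B. block G B \<Longrightarrow> complete_multipartite B"
    using assms(1) by (auto simp: block_complete_multipartite_def connected_graph_def)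
  obtain a where a: "a \<in> pverts G" using connected_graphD(2)[OF G] by blast
  show ?thesis
  proof (cases "pverts G = {a}")
    case True
    then show ?thesis by (rule exact_leaf_power_singleton)
  next
    case False
    then obtain b where b: "b \<in> pverts G" "a \<noteq> b" using a by blast
    note fin = connected_graphD(3)[OF G]
    have "2 \<le> card (pverts G)" using card_mono[OF fin, of "{a, b}"] a b by simp
    then obtain N E d where "skeleton G \<sigma> N E d"
      using skeleton_exists[OF G _ cm \<sigma>] by blast
    then show ?thesis using fin a b by (rule exact_leaf_power_of_skeleton)
  qed
qed

end
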